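(* Let $D\ge2$ be an integer, $E_0,\ldots,E_D\in\mathbb{R}$ and $\beta\in\mathbb{R}$. Let $Y_n$ be the number of vertices of height $n$ in the random tree with distribution $P_\infty$, and let $\mu=\sum_{i=0}^D i^2p_i^*-1>0$. Then, as $n\to\infty$, $$\frac{Y_n}{n}\cdot\frac{2}{\mu}\ \longrightarrow\ \Gamma\quad\text{in law},$$ where $\Gamma$ is a random variable with density $p(t)=te^{-t}$ for $t\ge0$ and $p(t)=0$ for $t<0$.
   Context: Trees. $\mathbb{N}=\{1,2,\ldots\}$. A plane tree is a rooted tree in which the child subtrees of every vertex are linearly ordered (up to isomorphism preserving the root and these orders). The branching number $\deg(v)$ is the number of children of $v$; the height of $v$ is its distance to the root; the height of a finite tree is the maximal height of its vertices. $\mathbb{T}_N$ is the set of plane trees on $N$ vertices with all branching numbers at most $D$; $\mu_N\{T\}=e^{-\beta E(T)}/Z_N$ for $T\in\mathbb{T}_N$, with $E(T)=\sum_{v\in V(T)}E_{\deg(v)}$ ($V(T)$ being the vertex set) and $Z_N=\sum_{T\in\mathbb{T}_N}e^{-\beta E(T)}$. $\pi_n T$ is the subtree of $T$ spanned by all vertices of height at most $n$. $S_n$ is the set of plane trees of height exactly $n$ with all branching numbers at most $D$. $P_n$ is the probability measure on $S_n$ that is the limit in total variation, as $N\to\infty$, of the push-forwards of $\mu_N$ under $\pi_n$ (this limit exists). $P_\infty$ is the unique probability measure on the space of all (finite or infinite) plane trees with branching numbers at most $D$ whose push-forward under $\pi_n$ is $P_n$ for every $n\in\mathbb{N}$; it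 is concentrated on infinite trees. Parameters. Let $\Delta=\{p\in[0,1]^{D+1}:\ \sum_{i=0}^D p_i=1,\ \sum_{i=0}^D i p_i=1\}$ and $J(p)=\sum_{i=0}^D p_i\ln p_i+\beta\sum_{i=0}^D p_iE_i$ (with $0\ln0=0$). $p^*=(p^*_0,\ldots,p^*_D)$ is the unique minimizer of $J$ on $\Delta$. (The number $\mu$ is the variance of the nondegenerate distribution $p^*$, hence positive.) *)

theory Defs
  imports "HOL-Probability.Probability"
begin

section \<open>Plane trees\<close>

text \<open>
  A plane tree is represented by its Ulam--Harris set of vertices: the root is the empty list
  and the children of \<open>v\<close> are \<open>v @ [0]\<close>, \<open>v @ [1]\<close>, \dots, in their linear order. Every locally
  finite plane tree, finite or infinite, has exactly one such representative in its isomorphism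
  class. The height of a vertex is the length of the list.
\<close>

type_synonym vertex = "nat list"

definition children :: "vertex set \<Rightarrow> vertex \<Rightarrow> nat set" where
  "children T v = {i. v @ [i] \<in> T}"

definition deg :: "vertex set \<Rightarrow> vertex \<Rightarrow> nat" where
  "deg T v = card (children T v)"

definition plane_tree :: "vertex set \<Rightarrow> bool" where
  "plane_tree T \<longleftrightarrow>
     [] \<in> T \<and>
     (\<forall>v i. v @ [i] \<in> T \<longrightarrow> v \<in> T) \<and>
     (\<forall>v i j. v @ [i] \<in> T \<longrightarrow> j < i \<longrightarrow> v @ [j] \<in> T) \<and>
     (\<forall>v\<in>T. finite (children T v))"

definition trees :: "nat \<Rightarrow> vertex set set" where
  "trees D = {T. plane_tree T \<and> (\<forall>v\<in>T. deg T v \<le> D)}"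

definition tree_height :: "vertex set \<Rightarrow> nat" where
  "tree_height T = Max (length ` T)"

definition trees_of_size :: "nat \<Rightarrow> nat \<Rightarrow> vertex set set" where
  "trees_of_size D N = {T \<in> trees D. finite T \<and> card T = N}"

definition trees_of_height :: "nat \<Rightarrow> nat \<Rightarrow> vertex set set" where
  "trees_of_height D n = {T \<in> trees D. finite T \<and> tree_height T = n}"

definition trunc :: "nat \<Rightarrow> vertex set \<Rightarrow> vertex set" where
  "trunc n T = {v \<in> T. length v \<le> n}"

definition generation_size :: "nat \<Rightarrow> vertex set \<Rightarrow> nat" where
  "generation_size n T = card {v \<in> T. length v = n}"


section \<open>Gibbs measures on trees with a given number of vertices\<close>

definition energy :: "(nat \<Rightarrow> real) \<Rightarrow> vertex set \<Rightarrow> real" where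
  "energy E T = (\<Sum>v\<in>T. E (deg T v))"

definition partition_function :: "nat \<Rightarrow> (nat \<Rightarrow> real) \<Rightarrow> real \<Rightarrow> nat \<Rightarrow> real" where
  "partition_function D E \<beta> N = (\<Sum>T\<in>trees_of_size D N. exp (- \<beta> * energy E T))"

text \<open>
  For \<open>D \<ge> 1\<close> and \<open>N \<ge> 1\<close> the weights below do define a probability mass function, see
  \<open>pmf_gibbs\<close>. For \<open>N = 0\<close> there is no tree, and the value is irrelevant.
\<close>

definition gibbs :: "nat \<Rightarrow> (nat \<Rightarrow> real) \<Rightarrow> real \<Rightarrow> nat \<Rightarrow> vertex set pmf" where
  "gibbs D E \<beta> N = embed_pmf (\<lambda>T. if T \<in> trees_of_size D N
     then exp (- \<beta> * energy E T) / partition_function D E \<beta> N else 0)"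

lemma plane_tree_take:
  assumes "plane_tree T" "v \<in> T"
  shows "take k v \<in> T"
  using assms(2)
proof (induction v rule: rev_induct)
  case (snoc x xs)
  then have "xs \<in> T" using assms(1) by (auto simp: plane_tree_def)
  then show ?case using snoc by (cases "k \<le> length xs") auto
qed simp

lemma trees_child_less:
  assumes "T \<in> trees D" "v @ [i] \<in> T"
  shows "i < D"
proof -
  have T: "plane_tree T" "v \<in> T" "deg T v \<le> D"
    using assms by (auto simp: trees_def plane_tree_def)
  have "j \<in> children T v" if "j \<le> i" for j
    using that assms(2) T(1) unfolding plane_tree_def children_def
    by (cases "j = i") auto
  then have "{..i} \<subseteq> children T v" by auto
  then have "card {..i} \<le> card (children T v)"
    using T by (intro card_mono) (auto simp: plane_tree_def)
  then show ?thesis using T(3) by (simp add: deg_def)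
qed

lemma trees_vertex_less:
  assumes "T \<in> trees D" "v \<in> T"
  shows "set v \<subseteq> {..<D}"
  using assms(2)
proof (induction v rule: rev_induct)
  case (snoc x xs)
  then have "xs \<in> T" using assms(1) by (auto simp: trees_def plane_tree_def)
  then show ?case using snoc trees_child_less[OF assms(1)] by auto
qed simp

lemma finite_trunc_range: "finite (trunc n ` trees D)"
proof (rule finite_subset)
  show "trunc n ` trees D \<subseteq> Pow {v. set v \<subseteq> {..<D} \<and> length v \<le> n}"
    using trees_vertex_less by (fastforce simp: trunc_def)
  show "finite (Pow {v. set v \<subseteq> {..<D} \<and> length v \<le> n})"
    by (simp add: finite_lists_length_le)
qed

lemma finite_trees_of_size: "finite (trees_of_size D N)"
proof (rule finite_subset)
  show "trees_of_size D N \<subseteq> Pow {v. set v \<subseteq> {..<D} \<and> length v \<le> N}"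
  proof safe
    fix T v i assume T: "T \<in> trees_of_size D N" "v \<in> T"
    then show "i \<in> set v \<Longrightarrow> i < D"
      using trees_vertex_less by (fastforce simp: trees_of_size_def)
    have tree: "plane_tree T" "finite T" "card T = N"
      using T by (auto simp: trees_of_size_def trees_def)
    have "inj_on (\<lambda>k. take k v) {..length v}"
    proof (rule inj_onI)
      fix x y assume "x \<in> {..length v}" "y \<in> {..length v}" "take x v = take y v"
      then show "x = y" by (metis atMost_iff length_take min.absorb2)
    qed
    then have "card {..length v} = card ((\<lambda>k. take k v) ` {..length v})"
      by (simp add: card_image)
    also have "\<dots> \<le> card T"
      using tree T plane_tree_take by (intro card_mono) auto
    finally show "length v \<le> N" using tree by simp
  qed
  show "finite (Pow {v. set v \<subseteq> {..<D} \<and> length v \<le> N})"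
    by (simp add: finite_lists_length_le)
qed

lemma trees_of_size_nonempty:
  assumes "D \<ge> 1" "N \<ge> 1"
  shows "trees_of_size D N \<noteq> {}"
proof -
  define T where "T = (\<lambda>k. replicate k (0::nat)) ` {..<N}"
  have rep: "v @ [i] = replicate k (0::nat) \<longleftrightarrow>
      i = 0 \<and> v = replicate (k - 1) 0 \<and> k \<ge> 1" for v i k
    by (cases k) (auto simp: replicate_append_same[symmetric])
  have T_iff: "v @ [i] \<in> T \<longleftrightarrow> (\<exists>k\<ge>1. k < N \<and> i = 0 \<and> v = replicate (k - 1) 0)" for v i
    unfolding T_def image_iff rep by auto
  have ch: "children T v \<subseteq> {0}" for v
    by (auto simp: children_def T_iff)
  have "plane_tree T"
    unfolding plane_tree_def
  proof (intro conjI allI impI ballI)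
    show "[] \<in> T" using assms by (force simp: T_def)
    show "v \<in> T" if "v @ [i] \<in> T" for v i using that by (auto simp: T_iff) (auto simp: T_def)
    show "v @ [j] \<in> T" if "v @ [i] \<in> T" "j < i" for v i j using that by (auto simp: T_iff)
    show "finite (children T v)" for v using ch finite_subset by blast
  qed
  moreover have "deg T v \<le> D" for v
    using card_mono[OF _ ch[of v]] assms by (auto simp: deg_def)
  moreover have "card T = N"
    unfolding T_def by (subst card_image) (auto intro!: inj_onI dest: arg_cong[of _ _ length])
  ultimately have "T \<in> trees_of_size D N"
    by (auto simp: trees_of_size_def trees_def T_def)
  then show ?thesis by auto
qed

lemma partition_function_pos:
  assumes "D \<ge> 1" "N \<ge> 1"
  shows "partition_function D E \<beta> N > 0"
  unfolding partition_function_def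
  using finite_trees_of_size trees_of_size_nonempty[OF assms] by (intro sum_pos) auto

lemma pmf_gibbs:
  assumes "D \<ge> 1" "N \<ge> 1"
  shows "pmf (gibbs D E \<beta> N) T = (if T \<in> trees_of_size D N
     then exp (- \<beta> * energy E T) / partition_function D E \<beta> N else 0)"
  unfolding gibbs_def
proof (rule pmf_embed_pmf)
  let ?Z = "partition_function D E \<beta> N"
  let ?f = "\<lambda>T. if T \<in> trees_of_size D N then exp (- \<beta> * energy E T) / ?Z else 0"
  have Z: "?Z > 0" using partition_function_pos[OF assms] .
  then show nonneg: "0 \<le> ?f T" for T by simp
  have "(\<integral>\<^sup>+T. ennreal (?f T) \<partial>count_space UNIV) = (\<Sum>T\<in>trees_of_size D N. ennreal (?f T))"
    using finite_trees_of_size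
    by (intro nn_integral_count_space') auto
  also have "\<dots> = ennreal (\<Sum>T\<in>trees_of_size D N. ?f T)"
    using Z by (intro sum_ennreal) simp
  also have "(\<Sum>T\<in>trees_of_size D N. ?f T)
      = (\<Sum>T\<in>trees_of_size D N. exp (- \<beta> * energy E T)) / ?Z"
    by (simp add: sum_divide_distrib)
  also have "\<dots> = 1" using Z by (simp add: partition_function_def)
  finally show "(\<integral>\<^sup>+T. ennreal (?f T) \<partial>count_space UNIV) = 1" by simp
qed


section \<open>Local limit\<close>

definition tv_dist :: "'a pmf \<Rightarrow> 'a pmf \<Rightarrow> real" where
  "tv_dist p q = (SUP A. \<bar>measure_pmf.prob p A - measure_pmf.prob q A\<bar>)"

definition is_trunc_limit ::
  "nat \<Rightarrow> (nat \<Rightarrow> real) \<Rightarrow> real \<Rightarrow> nat \<Rightarrow> vertex set pmf \<Rightarrow> bool" where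
  "is_trunc_limit D E \<beta> n Q \<longleftrightarrow>
     set_pmf Q \<subseteq> trees_of_height D n \<and>
     (\<lambda>N. tv_dist (map_pmf (trunc n) (gibbs D E \<beta> N)) Q) \<longlonglongrightarrow> 0"

text \<open>
  The space of finite and infinite trees carries the \<open>\<sigma>\<close>-algebra generated by the truncations,
  that is, by the cylinder sets.
\<close>

definition tree_space :: "nat \<Rightarrow> vertex set measure" where
  "tree_space D = sigma (trees D) {{T \<in> trees D. trunc n T = S} | n S. True}"

definition is_projective_limit ::
  "nat \<Rightarrow> (nat \<Rightarrow> vertex set pmf) \<Rightarrow> vertex set measure \<Rightarrow> bool" where
  "is_projective_limit D P M \<longleftrightarrow>
     prob_space M \<and> sets M = sets (tree_space D) \<and>
     (\<forall>n\<ge>1. distr M (count_space UNIV) (trunc n) = measure_pmf (P n))"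

lemma space_tree_space [simp]: "space (tree_space D) = trees D"
  unfolding tree_space_def by (rule space_measure_of) auto

lemma measurable_trunc [measurable]: "trunc n \<in> tree_space D \<rightarrow>\<^sub>M count_space UNIV"
proof -
  have cyl: "{T \<in> trees D. trunc n T = S} \<in> sets (tree_space D)" for S
    unfolding tree_space_def by (rule in_measure_of) auto
  have "trunc n -` A \<inter> trees D \<in> sets (tree_space D)" for A
  proof -
    have "trunc n -` A \<inter> trees D
        = (\<Union>S\<in>A \<inter> trunc n ` trees D. {T \<in> trees D. trunc n T = S})" by auto
    also have "\<dots> \<in> sets (tree_space D)"
      using cyl finite_trunc_range[of n D] by (intro sets.finite_UN) auto
    finally show ?thesis .
  qed
  then show ?thesis by (intro measurableI) auto
qed

lemma measurable_generation_size [measurable]: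
  "generation_size n \<in> tree_space D \<rightarrow>\<^sub>M count_space UNIV"
proof -
  have "generation_size n = generation_size n \<circ> trunc n"
    by (auto simp: fun_eq_iff generation_size_def trunc_def intro!: arg_cong[of _ _ card])
  also have "\<dots> \<in> tree_space D \<rightarrow>\<^sub>M count_space UNIV"
    by (rule measurable_comp[OF measurable_trunc]) simp
  finally show ?thesis .
qed


section \<open>The variational problem\<close>

text \<open>Vectors indexed by \<open>0, \<dots>, D\<close> are functions on \<open>nat\<close> of which only these values are used.\<close>

definition simplex_mean_one :: "nat \<Rightarrow> (nat \<Rightarrow> real) set" where
  "simplex_mean_one D = {p. (\<forall>i\<le>D. 0 \<le> p i \<and> p i \<le> 1) \<and>
     (\<Sum>i\<le>D. p i) = 1 \<and> (\<Sum>i\<le>D. real i * p i) = 1}"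

text \<open>The convention \<open>0 ln 0 = 0\<close> holds in the formula below because \<open>0 * x = 0\<close>.\<close>

definition free_energy :: "nat \<Rightarrow> (nat \<Rightarrow> real) \<Rightarrow> real \<Rightarrow> (nat \<Rightarrow> real) \<Rightarrow> real" where
  "free_energy D E \<beta> p = (\<Sum>i\<le>D. p i * ln (p i)) + \<beta> * (\<Sum>i\<le>D. p i * E i)"

definition offspring_variance :: "nat \<Rightarrow> (nat \<Rightarrow> real) \<Rightarrow> real" where
  "offspring_variance D p = (\<Sum>i\<le>D. (real i)\<^sup>2 * p i) - 1"

end

theory Submission
  imports Defs
begin

text \<open>
  The minimizer \<open>p\<close> is the exponential tilt \<open>p\<^sub>i = C t\<^sup>i exp (- \<beta> E\<^sub>i)\<close> of mean one, so the Gibbs measure on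
  trees with \<open>N\<close> vertices is the critical Galton--Watson tree with offspring law \<open>p\<close> conditioned to
  have size \<open>N\<close>. Let \<open>z\<^sub>N\<close> be the probability of size \<open>N\<close>. The existence of the limit \<open>P\<^sub>1\<close> gives
  \<open>z\<^sub>N / z\<^sub>N\<^sub>+\<^sub>1 \<longrightarrow> r\<close>, and \<open>r \<ge> 1\<close> since \<open>z\<^sub>N \<le> 1\<close>. Among the conditioned trees that start with a given
  tree \<open>S\<close> of height \<open>n\<close> with \<open>k\<close> vertices in generation \<open>n\<close>, consider those in which only one of the \<open>k\<close>
  subtrees is large; as the critical tree is finite almost surely, they show \<open>P\<^sub>n(S) \<ge> k w(S)\<close>, where
  \<open>w(S)\<close> is the Galton--Watson probability of starting with \<open>S\<close>. Both sides sum to one, the right-hand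
  side because generation \<open>n\<close> has mean size one, hence \<open>P\<^sub>n(S) = k w(S)\<close>.

  Consequently \<open>Y\<^sub>n\<close> has generating function \<open>s f\<^sub>n'(s)\<close>, where \<open>f\<^sub>n\<close> is the \<open>n\<close>-th iterate of the offspring
  generating function \<open>f\<close>. From \<open>1 / (1 - f(s)) = 1 / (1 - s) + \<mu> / 2 + O(1 - s)\<close> and
  \<open>f'(s) = ((1 - f(s)) / (1 - s))\<^sup>2 + O((1 - s)\<^sup>2)\<close> on the complex unit disc, the derivative at
  \<open>s = exp (2 i \<theta> / (\<mu> n))\<close> tends to \<open>1 / (1 - i \<theta>)\<^sup>2\<close>, the characteristic function of \<open>\<Gamma>\<close>. Levy's
  continuity theorem concludes.
\<close>

section \<open>Grafting trees\<close>

definition level :: "nat \<Rightarrow> vertex set \<Rightarrow> vertex set" where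
  "level n T = {v \<in> T. length v = n}"

definition below :: "nat \<Rightarrow> vertex set \<Rightarrow> vertex set" where
  "below n T = {v \<in> T. length v < n}"

definition subtree :: "vertex set \<Rightarrow> vertex \<Rightarrow> vertex set" where
  "subtree T v = {u. v @ u \<in> T}"

text \<open>Vertices of \<open>S\<close> above height \<open>n\<close> are discarded, so the result
  depends on \<open>S\<close> only through \<open>trunc n S\<close> and on \<open>g\<close> only
  through its values on \<open>level n S\<close>.\<close>

definition graft :: "nat \<Rightarrow> vertex set \<Rightarrow> (vertex \<Rightarrow> vertex set) \<Rightarrow> vertex set" where
  "graft n S g =
     {w. if length w < n then w \<in> S else take n w \<in> S \<and> drop n w \<in> g (take n w)}"

lemma generation_size_eq_card_level: "generation_size n T = card (level n T)"
  by (simp add: generation_size_def level_def)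

lemma root_in_tree: "T \<in> trees D \<Longrightarrow> [] \<in> T"
  by (simp add: trees_def plane_tree_def)

lemma tree_prefix_closed: "T \<in> trees D \<Longrightarrow> v @ u \<in> T \<Longrightarrow> v \<in> T"
  using plane_tree_take[of T "v @ u" "length v"] by (simp add: trees_def)

lemma finite_below_tree: "T \<in> trees D \<Longrightarrow> finite (below n T)"
  by (rule finite_subset[of _ "{v. set v \<subseteq> {..<D} \<and> length v \<le> n}"])
     (auto simp: below_def finite_lists_length_le dest: trees_vertex_less)

lemma finite_level: "T \<in> trees D \<Longrightarrow> finite (level n T)"
  by (rule finite_subset[OF _ finite_below_tree[of T D "Suc n"]]) (auto simp: level_def below_def)

lemma in_treesI:
  assumes "[] \<in> T"
    and "\<And>v i. v @ [i] \<in> T \<Longrightarrow> v \<in> T"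
    and "\<And>v i j. v @ [i] \<in> T \<Longrightarrow> j < i \<Longrightarrow> v @ [j] \<in> T"
    and "\<And>v. v \<in> T \<Longrightarrow> finite (children T v) \<and> deg T v \<le> D"
  shows "T \<in> trees D"
  using assms unfolding trees_def plane_tree_def by blast

lemma subtree_in_trees:
  assumes T: "T \<in> trees D" "v \<in> T"
  shows "subtree T v \<in> trees D"
proof (rule in_treesI)
  have ch: "children (subtree T v) u = children T (v @ u)" for u
    by (simp add: children_def subtree_def)
  show "finite (children (subtree T v) u) \<and> deg (subtree T v) u \<le> D" if "u \<in> subtree T v" for u
    using T that by (simp add: deg_def ch) (auto simp: subtree_def trees_def plane_tree_def deg_def)
  show "u \<in> subtree T v" if "u @ [i] \<in> subtree T v" for u i
    using tree_prefix_closed[OF T(1), of "v @ u" "[i]"] that by (simp add: subtree_def)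
  show "u @ [j] \<in> subtree T v" if "u @ [i] \<in> subtree T v" "j < i" for u i j
  proof -
    have "(v @ u) @ [i] \<in> T" using that by (simp add: subtree_def)
    then have "(v @ u) @ [j] \<in> T"
      using T(1) that(2) unfolding trees_def plane_tree_def by blast
    then show ?thesis by (simp add: subtree_def)
  qed
qed (use T in \<open>simp add: subtree_def\<close>)

lemma trunc_in_trees:
  assumes T: "T \<in> trees D"
  shows "trunc n T \<in> trees D"
proof (rule in_treesI)
  show "finite (children (trunc n T) v) \<and> deg (trunc n T) v \<le> D" if "v \<in> trunc n T" for v
  proof -
    have "v \<in> T" using that by (simp add: trunc_def)
    then have *: "finite (children T v)" "deg T v \<le> D" using T by (auto simp: trees_def plane_tree_def)
    have "children (trunc n T) v \<subseteq> children T v" by (auto simp: children_def trunc_def)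
    then have "deg (trunc n T) v \<le> deg T v" "finite (children (trunc n T) v)"
      using *(1) by (auto simp: deg_def intro: card_mono finite_subset)
    then show ?thesis using *(2) by simp
  qed
qed (use T in \<open>auto simp: trees_def plane_tree_def trunc_def\<close>)

locale grafting =
  fixes D n :: nat and S :: "vertex set" and g :: "vertex \<Rightarrow> vertex set"
  assumes base: "S \<in> trees D"
    and scions: "v \<in> level n S \<Longrightarrow> g v \<in> trees D"
begin

lemma graft_below: "length w < n \<Longrightarrow> w \<in> graft n S g \<longleftrightarrow> w \<in> S"
  by (simp add: graft_def)

lemma graft_at_level: "length v = n \<Longrightarrow> v \<in> graft n S g \<longleftrightarrow> v \<in> S"
  using scions[of v] root_in_tree by (auto simp: graft_def level_def)

lemma graft_append: "v \<in> level n S \<Longrightarrow> v @ u \<in> graft n S g \<longleftrightarrow> u \<in> g v"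
  by (auto simp: graft_def level_def)

lemma trunc_graft: "trunc n (graft n S g) = trunc n S"
  using graft_below graft_at_level by (auto simp: trunc_def le_less)

lemma subtree_graft: "v \<in> level n S \<Longrightarrow> subtree (graft n S g) v = g v"
  by (simp add: subtree_def graft_append)

lemma graft_cases:
  assumes "w \<in> graft n S g"
  obtains "length w < n" "w \<in> S" | v u where "w = v @ u" "v \<in> level n S" "u \<in> g v"
proof (cases "length w < n")
  case False
  then have "take n w \<in> level n S" "drop n w \<in> g (take n w)"
    using assms by (auto simp: graft_def level_def)
  then show ?thesis using that(2)[of "take n w" "drop n w"] by simp
qed (use that assms in \<open>auto simp: graft_def\<close>)

lemma children_graft_below: "length w < n \<Longrightarrow> children (graft n S g) w = children S w"
  using graft_below[of "w @ [i]" for i] graft_at_level[of "w @ [i]" for i]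
  by (cases "Suc (length w) = n") (auto simp: children_def)

lemma children_graft_append: "v \<in> level n S \<Longrightarrow> children (graft n S g) (v @ u) = children (g v) u"
  using graft_append[of v "u @ [i]" for i] by (simp add: children_def)

lemma deg_graft_below: "length w < n \<Longrightarrow> deg (graft n S g) w = deg S w"
  and deg_graft_append: "v \<in> level n S \<Longrightarrow> deg (graft n S g) (v @ u) = deg (g v) u"
  by (simp_all add: deg_def children_graft_below children_graft_append)

lemma graft_in_trees: "graft n S g \<in> trees D"
proof (rule in_treesI)
  show "[] \<in> graft n S g"
    using graft_below[of "[]"] graft_at_level[of "[]"] root_in_tree[OF base] by (cases "n = 0") auto
  fix w i
  have snoc: "length w < n \<and> w \<in> S \<or> (\<exists>v u. w = v @ u \<and> v \<in> level n S \<and> u @ [i] \<in> g v)"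
    if "w @ [i] \<in> graft n S g" for i
  proof (cases "length w < n")
    case True
    then have "w @ [i] \<in> S"
      using children_graft_below[OF True] that by (auto simp: children_def)
    then show ?thesis using True tree_prefix_closed[OF base] by blast
  next
    case False
    from that show ?thesis
    proof (cases rule: graft_cases)
      case (2 v u)
      then show ?thesis using False by (cases u rule: rev_cases) (auto simp: level_def)
    qed (use False in simp)
  qed
  show "w \<in> graft n S g" if "w @ [i] \<in> graft n S g"
    using snoc[OF that] tree_prefix_closed[OF scions] graft_below graft_append by blast
  show "w @ [j] \<in> graft n S g" if "w @ [i] \<in> graft n S g" "j < i" for j
  proof (cases "length w < n")
    case True
    then show ?thesis
      using that children_graft_below[OF True] base
      unfolding children_def trees_def plane_tree_def by blast
  next
    case False
    with snoc[OF that(1)] obtain v u where "w = v @ u" "v \<in> level n S" "u @ [i] \<in> g v" by auto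
    moreover from this have "u @ [j] \<in> g v"
      using scions that(2) unfolding trees_def plane_tree_def by blast
    ultimately show ?thesis by (simp add: graft_append)
  qed
next
  fix w assume "w \<in> graft n S g"
  then show "finite (children (graft n S g) w) \<and> deg (graft n S g) w \<le> D"
  proof (cases rule: graft_cases)
    case 1
    then show ?thesis
      using base by (auto simp: children_graft_below deg_graft_below trees_def plane_tree_def)
  next
    case (2 v u)
    then show ?thesis
      using scions[of v] by (auto simp: children_graft_append deg_graft_append trees_def plane_tree_def)
  qed
qed

lemma graft_eq: "graft n S g = below n S \<union> (\<Union>v\<in>level n S. (@) v ` g v)"
proof (intro set_eqI iffI)
  fix w assume "w \<in> graft n S g"
  then show "w \<in> below n S \<union> (\<Union>v\<in>level n S. (@) v ` g v)"
    by (cases rule: graft_cases) (auto simp: below_def)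
qed (auto simp: below_def graft_below graft_append)

lemma below_graft:
  "below (n + h) (graft n S g) = below n S \<union> (\<Union>v\<in>level n S. (@) v ` below h (g v))"
  by (auto simp: graft_eq) (auto simp: below_def level_def)

lemma level_graft: "level (n + h) (graft n S g) = (\<Union>v\<in>level n S. (@) v ` level h (g v))"
  by (auto simp: graft_eq) (auto simp: below_def level_def)

end

text \<open>Words of length at least \<open>n\<close> are sorted by their prefix of length
  \<open>n\<close>, so the pieces are disjoint, and \<open>u \<mapsto> v @ u\<close> is injective.
  Working in a commutative monoid serves both cardinalities (sums) and tree weights
  (products).\<close>

lemma (in comm_monoid_set) below_union_append:
  assumes S: "S \<in> trees D" and A: "\<And>v. v \<in> level n S \<Longrightarrow> finite (A v)"
  shows "F h (below n S \<union> (\<Union>v\<in>level n S. (@) v ` A v)) =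
         F h (below n S) \<^bold>* F (\<lambda>v. F (\<lambda>u. h (v @ u)) (A v)) (level n S)"
proof -
  have fin: "finite (below n S)" "finite (level n S)"
    using S by (simp_all add: finite_below_tree finite_level)
  have "F h (\<Union>v\<in>level n S. (@) v ` A v) = F (\<lambda>v. F h ((@) v ` A v)) (level n S)"
    using A fin by (intro UNION_disjoint) (auto simp: level_def)
  also have "\<dots> = F (\<lambda>v. F (\<lambda>u. h (v @ u)) (A v)) (level n S)"
    by (rule cong[OF refl], subst reindex) (auto simp: inj_on_def)
  finally show ?thesis
    using A fin by (subst union_disjoint) (auto simp: below_def level_def)
qed

text \<open>Inverse of grafting: a vertex of height at least \<open>n\<close> splits uniquely into
  its ancestor of height \<open>n\<close> and a vertex of the subtree there.\<close>

lemma graft_subtrees: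
  assumes "T \<in> trees D" "trunc n T = trunc n S" "\<And>v. v \<in> level n S \<Longrightarrow> g v = subtree T v"
  shows "graft n S g = T"
proof -
  have low: "w \<in> T \<longleftrightarrow> w \<in> S" if "length w \<le> n" for w
    using assms(2) that by (auto simp: trunc_def set_eq_iff)
  have "w \<in> graft n S g \<longleftrightarrow> w \<in> T" for w
  proof (cases "length w < n")
    case False
    then have "length (take n w) = n" by simp
    then have "take n w \<in> T \<longleftrightarrow> take n w \<in> S"
      and "take n w \<in> S \<Longrightarrow> g (take n w) = subtree T (take n w)"
      using low[of "take n w"] assms(3)[of "take n w"] by (simp_all add: level_def)
    moreover have "drop n w \<in> subtree T (take n w) \<longleftrightarrow> w \<in> T"
      by (simp add: subtree_def)
    ultimately show ?thesis
      using False tree_prefix_closed[OF assms(1), of "take n w" "drop n w"]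
      by (auto simp: graft_def)
  qed (simp add: graft_def low)
  then show ?thesis by blast
qed

text \<open>The scions can be read off as subtrees at height \<open>n\<close>; \<open>PiE\<close>
  fixes the values elsewhere, which the graft does not see.\<close>

lemma inj_on_graft:
  assumes "S \<in> trees D"
  shows "inj_on (graft n S) (PiE (level n S) (\<lambda>_. trees D))"
proof (rule inj_onI)
  fix f g assume *: "f \<in> PiE (level n S) (\<lambda>_. trees D)" "g \<in> PiE (level n S) (\<lambda>_. trees D)"
    and eq: "graft n S f = graft n S g"
  have "f v = g v" if "v \<in> level n S" for v
    using grafting.subtree_graft[of D n S f v] grafting.subtree_graft[of D n S g v] * assms that
    unfolding eq grafting_def by (auto simp: PiE_mem)
  then show "f = g" using * by (metis PiE_ext)
qed

text \<open>Combinatorial form of the branching property: once the first \<open>n\<close>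
  generations are fixed, the subtrees at height \<open>n\<close> are chosen independently. A sum
  over a fibre of \<open>trunc n\<close> becomes a sum over \<open>PiE\<close>, which factorises.
  \<open>Q\<close> will restrict the height or the size of the subtrees.\<close>

lemma bij_betw_graft:
  assumes S: "S \<in> trees D" and Q: "Q \<subseteq> trees D"
  shows "bij_betw (graft n S) (PiE (level n S) (\<lambda>_. Q))
           {T \<in> trees D. trunc n T = trunc n S \<and> (\<forall>v\<in>level n S. subtree T v \<in> Q)}"
proof (rule bij_betw_imageI)
  show "inj_on (graft n S) (PiE (level n S) (\<lambda>_. Q))"
    by (rule inj_on_subset[OF inj_on_graft[OF S]]) (use Q in \<open>auto simp: PiE_iff\<close>)
  show "graft n S ` PiE (level n S) (\<lambda>_. Q) =
      {T \<in> trees D. trunc n T = trunc n S \<and> (\<forall>v\<in>level n S. subtree T v \<in> Q)}"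
  proof (intro set_eqI iffI)
    fix T assume "T \<in> graft n S ` PiE (level n S) (\<lambda>_. Q)"
    then obtain g where g: "g \<in> PiE (level n S) (\<lambda>_. Q)" "T = graft n S g" by auto
    interpret grafting D n S g by standard (use S Q g in auto)
    show "T \<in> {T \<in> trees D. trunc n T = trunc n S \<and> (\<forall>v\<in>level n S. subtree T v \<in> Q)}"
      using g graft_in_trees trunc_graft subtree_graft by (auto simp: PiE_mem)
  next
    fix T assume *: "T \<in> {T \<in> trees D. trunc n T = trunc n S \<and> (\<forall>v\<in>level n S. subtree T v \<in> Q)}"
    then have "graft n S (restrict (subtree T) (level n S)) = T"
      by (intro graft_subtrees) auto
    then show "T \<in> graft n S ` PiE (level n S) (\<lambda>_. Q)"
      using * by (intro image_eqI[of _ _ "restrict (subtree T) (level n S)"]) auto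
  qed
qed

section \<open>Trees of bounded height and their Galton--Watson weights\<close>

definition trees_upto :: "nat \<Rightarrow> nat \<Rightarrow> vertex set set" where
  "trees_upto D n = {T \<in> trees D. \<forall>v\<in>T. length v \<le> n}"

definition trees_below :: "nat \<Rightarrow> nat \<Rightarrow> vertex set set" where
  "trees_below D n = {T \<in> trees D. \<forall>v\<in>T. length v < n}"

definition tree_prob :: "(nat \<Rightarrow> real) \<Rightarrow> vertex set \<Rightarrow> real" where
  "tree_prob p T = (\<Prod>v\<in>T. p (deg T v))"

text \<open>The Galton--Watson probability that the first \<open>n\<close> generations agree with
  those of \<open>T\<close>. Vertices of height \<open>n\<close> contribute no factor because their
  offspring lies beyond the truncation.\<close>

definition trunc_prob :: "(nat \<Rightarrow> real) \<Rightarrow> nat \<Rightarrow> vertex set \<Rightarrow> real" where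
  "trunc_prob p n T = (\<Prod>v\<in>below n T. p (deg T v))"

lemma trunc_upto: "T \<in> trees_upto D n \<Longrightarrow> trunc n T = T"
  by (auto simp: trees_upto_def trunc_def)

lemma trunc_in_upto: "T \<in> trees D \<Longrightarrow> trunc n T \<in> trees_upto D n"
  using trunc_in_trees[of T D n] by (auto simp: trees_upto_def trunc_def)

lemma finite_trees_upto: "finite (trees_upto D n)"
  using trunc_upto by (intro finite_subset[OF _ finite_trunc_range[of n D]])
    (force simp: trees_upto_def)

lemma trees_below_upto: "trees_below D n = {T \<in> trees_upto D n. level n T = {}}"
  by (auto simp: trees_upto_def trees_below_def level_def le_less)

lemma finite_trees_below: "finite (trees_below D n)"
  by (simp add: trees_below_upto finite_trees_upto)

lemma finite_tree_upto: "T \<in> trees_upto D n \<Longrightarrow> finite T"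
  using finite_below_tree[of T D "Suc n"] by (auto simp: trees_upto_def below_def less_Suc_eq_le
    elim!: rev_finite_subset)

lemma trunc_prob_below: "T \<in> trees_below D n \<Longrightarrow> trunc_prob p n T = tree_prob p T"
  by (auto simp: trunc_prob_def tree_prob_def trees_below_def below_def intro!: prod.cong)

lemma trees_of_height_subset: "trees_of_height D n \<subseteq> trees_upto D n"
  by (auto simp: trees_of_height_def trees_upto_def tree_height_def)

context grafting
begin

lemma trunc_prob_graft:
  "trunc_prob p (n + h) (graft n S g) =
     trunc_prob p n S * (\<Prod>v\<in>level n S. trunc_prob p h (g v))"
proof -
  have "trunc_prob p (n + h) (graft n S g) = (\<Prod>w\<in>below n S. p (deg (graft n S g) w)) *
      (\<Prod>v\<in>level n S. \<Prod>u\<in>below h (g v). p (deg (graft n S g) (v @ u)))"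
    unfolding trunc_prob_def below_graft
    by (rule prod.below_union_append[OF base]) (rule finite_below_tree[OF scions])
  also have "\<dots> = trunc_prob p n S * (\<Prod>v\<in>level n S. trunc_prob p h (g v))"
    unfolding trunc_prob_def
    by (intro arg_cong2[of _ _ _ _ "(*)"] prod.cong refl)
       (auto simp: deg_graft_append deg_graft_below below_def)
  finally show ?thesis .
qed

lemma generation_size_graft:
  "generation_size (n + h) (graft n S g) = (\<Sum>v\<in>level n S. generation_size h (g v))"
  unfolding generation_size_eq_card_level level_graft
proof (subst card_UN_disjoint)
  show "\<forall>u\<in>level n S. \<forall>v\<in>level n S. u \<noteq> v \<longrightarrow>
      (@) u ` level h (g u) \<inter> (@) v ` level h (g v) = {}"
    by (auto simp: level_def)
qed (simp_all add: finite_level[OF base] finite_level[OF scions] card_image inj_on_def)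

context
  assumes fin: "\<And>v. v \<in> level n S \<Longrightarrow> finite (g v)"
begin

lemma finite_graft: "finite (graft n S g)"
  using fin by (simp add: graft_eq finite_below_tree[OF base] finite_level[OF base])

lemma card_graft: "card (graft n S g) = card (below n S) + (\<Sum>v\<in>level n S. card (g v))"
  unfolding graft_eq card_eq_sum by (rule sum.below_union_append[OF base fin])

lemma tree_prob_graft:
  "tree_prob p (graft n S g) = trunc_prob p n S * (\<Prod>v\<in>level n S. tree_prob p (g v))"
proof -
  have "tree_prob p (graft n S g) = (\<Prod>w\<in>below n S. p (deg (graft n S g) w)) *
      (\<Prod>v\<in>level n S. \<Prod>u\<in>g v. p (deg (graft n S g) (v @ u)))"
    unfolding tree_prob_def by (subst (1) graft_eq, rule prod.below_union_append[OF base fin])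
  also have "\<dots> = trunc_prob p n S * (\<Prod>v\<in>level n S. tree_prob p (g v))"
    unfolding tree_prob_def trunc_prob_def
    by (intro arg_cong2[of _ _ _ _ "(*)"] prod.cong refl)
       (auto simp: deg_graft_append deg_graft_below below_def)
  finally show ?thesis .
qed

end

end

section \<open>Generating functions of the generations\<close>

text \<open>The field is left open: real arguments give the extinction probability and the
  normalisation, complex ones the characteristic function.\<close>

definition offspring_gf :: "nat \<Rightarrow> (nat \<Rightarrow> real) \<Rightarrow> 'a \<Rightarrow> 'a::real_normed_field" where
  "offspring_gf D p s = (\<Sum>i\<le>D. of_real (p i) * s ^ i)"

text \<open>The probability generating function of the size of generation \<open>n\<close> of the
  unconditioned Galton--Watson tree, as a finite sum over the possible truncations.\<close>

definition level_gf :: "nat \<Rightarrow> (nat \<Rightarrow> real) \<Rightarrow> nat \<Rightarrow> 'a \<Rightarrow> 'a::real_normed_field" where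
  "level_gf D p n s =
     (\<Sum>T\<in>trees_upto D n. of_real (trunc_prob p n T) * s ^ generation_size n T)"

definition star :: "nat \<Rightarrow> vertex set" where
  "star k = insert [] ((\<lambda>i. [i]) ` {..<k})"

text \<open>A tree has height at most \<open>n + h\<close> exactly when its subtrees at height
  \<open>n\<close> have height at most \<open>h\<close>; this brings the fibre into the shape
  required by \<open>bij_betw_graft\<close>.\<close>

lemma trees_upto_fiber:
  assumes "S \<in> trees_upto D n"
  shows "{T \<in> trees_upto D (n + h). trunc n T = S} =
    {T \<in> trees D. trunc n T = trunc n S \<and> (\<forall>v\<in>level n S. subtree T v \<in> trees_upto D h)}"
proof -
  note S = trunc_upto[OF assms]
  have "(\<forall>w\<in>T. length w \<le> n + h) \<longleftrightarrow> (\<forall>v\<in>level n S. subtree T v \<in> trees_upto D h)"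
    if T: "T \<in> trees D" "trunc n T = S" for T
  proof (intro iffI ballI)
    fix v assume *: "\<forall>w\<in>T. length w \<le> n + h" "v \<in> level n S"
    then have "v \<in> T" using T(2) by (auto simp: level_def trunc_def)
    then show "subtree T v \<in> trees_upto D h"
      using subtree_in_trees[OF T(1)] * by (auto simp: trees_upto_def subtree_def level_def)
  next
    fix w assume *: "\<forall>v\<in>level n S. subtree T v \<in> trees_upto D h" "w \<in> T"
    show "length w \<le> n + h"
    proof (cases "length w < n")
      case False
      have "take n w \<in> T"
        using tree_prefix_closed[OF T(1), of "take n w" "drop n w"] *(2) by simp
      then have "take n w \<in> level n S" using False T(2) by (auto simp: level_def trunc_def)
      then have "subtree T (take n w) \<in> trees_upto D h" "drop n w \<in> subtree T (take n w)"
        using * by (auto simp: subtree_def)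
      then have "length (drop n w) \<le> h" unfolding trees_upto_def by blast
      then show ?thesis by simp
    qed simp
  qed
  then show ?thesis using S by (auto simp: trees_upto_def)
qed

text \<open>Group the trees by their first \<open>n\<close> generations. In each group, weights
  multiply and generation sizes add over the subtrees, so every vertex of height \<open>n\<close>
  contributes one factor \<open>level_gf D p h s\<close>.\<close>

lemma level_gf_add: "level_gf D p (n + h) s = level_gf D p n (level_gf D p h s)"
proof -
  let ?t = "\<lambda>n T. of_real (trunc_prob p n T)"
  let ?f = "\<lambda>n T. ?t n T * s ^ generation_size n T"
  have fiber: "(\<Sum>T\<in>{T \<in> trees_upto D (n + h). trunc n T = S}. ?f (n + h) T) =
      ?t n S * level_gf D p h s ^ generation_size n S"
    if S: "S \<in> trees_upto D n" for S
  proof -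
    have tr: "S \<in> trees D" using S by (simp add: trees_upto_def)
    have "(\<Sum>T\<in>{T \<in> trees_upto D (n + h). trunc n T = S}. ?f (n + h) T) =
        (\<Sum>g\<in>PiE (level n S) (\<lambda>_. trees_upto D h). ?f (n + h) (graft n S g))"
      unfolding trees_upto_fiber[OF S]
      by (rule sum.reindex_bij_betw[symmetric], rule bij_betw_graft[OF tr])
         (auto simp: trees_upto_def)
    also have "\<dots> = (\<Sum>g\<in>PiE (level n S) (\<lambda>_. trees_upto D h). ?t n S * (\<Prod>v\<in>level n S. ?f h (g v)))"
    proof (rule sum.cong[OF refl])
      fix g assume g: "g \<in> PiE (level n S) (\<lambda>_. trees_upto D h)"
      interpret grafting D n S g
        by standard (use tr g in \<open>auto simp: trees_upto_def PiE_iff\<close>)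
      show "?f (n + h) (graft n S g) = ?t n S * (\<Prod>v\<in>level n S. ?f h (g v))"
        by (simp add: trunc_prob_graft generation_size_graft prod.distrib power_sum)
    qed
    also have "\<dots> = ?t n S * (\<Prod>v\<in>level n S. \<Sum>T\<in>trees_upto D h. ?f h T)"
      unfolding sum_distrib_left[symmetric]
      by (subst prod_sum_PiE) (simp_all add: finite_level[OF tr] finite_trees_upto)
    also have "\<dots> = ?t n S * level_gf D p h s ^ generation_size n S"
      by (simp add: level_gf_def generation_size_eq_card_level)
    finally show ?thesis .
  qed
  have "level_gf D p (n + h) s =
      (\<Sum>S\<in>trees_upto D n. \<Sum>T\<in>{T \<in> trees_upto D (n + h). trunc n T = S}. ?f (n + h) T)"
    unfolding level_gf_def
    by (rule sum.group[symmetric])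
       (auto simp: finite_trees_upto intro!: trunc_in_upto, auto simp: trees_upto_def)
  then show ?thesis by (simp add: fiber level_gf_def[of D p n])
qed

lemma children_star: "children (star k) [] = {..<k}" "v \<noteq> [] \<Longrightarrow> children (star k) v = {}"
  by (auto simp: children_def star_def)

lemma star_in_trees: "k \<le> D \<Longrightarrow> star k \<in> trees D"
proof (rule in_treesI)
  fix v assume "k \<le> D"
  then show "finite (children (star k) v) \<and> deg (star k) v \<le> D"
    by (cases "v = []") (auto simp: children_star deg_def)
qed (auto simp: star_def)

lemma trees_upto_1: "trees_upto D 1 = star ` {..D}"
proof (intro set_eqI iffI)
  fix T assume T: "T \<in> trees_upto D 1"
  define k where "k = deg T []"
  have tr: "T \<in> trees D" using T by (simp add: trees_upto_def)
  have fin: "finite (children T [])" and deg: "k \<le> D"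
    using tr root_in_tree[OF tr] by (auto simp: k_def trees_def plane_tree_def)
  have down: "j \<in> children T []" if "i \<in> children T []" "j < i" for i j
    using that tr append_Nil unfolding trees_def plane_tree_def children_def
    by (metis (mono_tags, lifting) mem_Collect_eq)
  have "children T [] = {..<k}"
  proof (cases "children T [] = {}")
    case False
    then have "children T [] = {..Max (children T [])}"
      using down[OF Max_in[OF fin False]] Max_in[OF fin False] Max_ge[OF fin]
      by (auto simp: le_less)
    then show ?thesis unfolding k_def deg_def by (metis card_atMost lessThan_Suc_atMost)
  qed (simp add: k_def deg_def)
  then have ch: "[i] \<in> T \<longleftrightarrow> i < k" for i by (auto simp: children_def)
  have "w \<in> T \<longleftrightarrow> w \<in> star k" for w
  proof (cases "length w \<le> 1")
    case True
    then consider "w = []" | i where "w = [i]" by (cases w) auto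
    then show ?thesis by cases (auto simp: star_def root_in_tree[OF tr] ch)
  qed (use T in \<open>auto simp: trees_upto_def star_def\<close>)
  then show "T \<in> star ` {..D}" using deg by blast
qed (auto simp: trees_upto_def star_in_trees, auto simp: star_def)

lemma inj_star: "inj star"
  by (rule injI) (metis card_lessThan children_star(1))

lemma trunc_prob_star: "trunc_prob p 1 (star k) = p k"
proof -
  have "below 1 (star k) = {[]}" by (auto simp: below_def star_def)
  then show ?thesis by (simp add: trunc_prob_def deg_def children_star)
qed

lemma level_star: "level 1 (star k) = (\<lambda>i. [i]) ` {..<k}"
  by (auto simp: level_def star_def)

lemma generation_size_star: "generation_size 1 (star k) = k"
  unfolding generation_size_eq_card_level level_star by (simp add: card_image inj_on_def)

lemma level_gf_0: "level_gf D p 0 s = s"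
proof -
  have "trees_upto D 0 = {{[]}}"
  proof -
    have "{[]} \<in> trees D" using star_in_trees[of 0 D] by (simp add: star_def)
    then show ?thesis using root_in_tree by (auto simp: trees_upto_def)
  qed
  then show ?thesis
    by (simp add: level_gf_def trunc_prob_def below_def generation_size_eq_card_level level_def)
qed

lemma level_gf_1: "level_gf D p 1 s = offspring_gf D p s"
  unfolding level_gf_def trees_upto_1 offspring_gf_def
  by (subst sum.reindex) (auto simp: trunc_prob_star generation_size_star inj_star[THEN inj_on_subset]
      simp del: One_nat_def)

lemma level_gf_eq_funpow: "level_gf D p n s = (offspring_gf D p ^^ n) s"
proof (induction n arbitrary: s)
  case (Suc n)
  have "level_gf D p (n + 1) s = level_gf D p n (offspring_gf D p s)"
    by (simp only: level_gf_add level_gf_1)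
  then show ?case by (simp add: Suc funpow_swap1)
qed (simp add: level_gf_0)

text \<open>At \<open>s = 0\<close> only trees with empty generation \<open>n\<close> survive,
  because \<open>0 ^ 0 = 1\<close>; for these the truncated weight is the full weight.\<close>

lemma extinction_prob:
  "(\<Sum>T\<in>trees_below D n. tree_prob p T) = (offspring_gf D p ^^ n) 0"
proof -
  have "(\<Sum>T\<in>trees_below D n. tree_prob p T) =
      (\<Sum>T\<in>trees_upto D n. if level n T = {} then trunc_prob p n T else 0)"
    using trunc_prob_below[of _ D n p] unfolding trees_below_upto
    by (subst sum.inter_filter[symmetric]) (auto simp: finite_trees_upto intro!: sum.cong)
  also have "\<dots> = level_gf D p n 0"
    unfolding level_gf_def
    by (intro sum.cong refl)
       (auto simp: generation_size_eq_card_level trees_upto_def finite_level power_0_left)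
  finally show ?thesis by (simp add: level_gf_eq_funpow)
qed

section \<open>Iterates of a critical generating function\<close>

text \<open>For \<open>i = 0\<close> the truncated exponent \<open>i - 1\<close> is harmless, since
  the factor \<open>of_nat i\<close> vanishes.\<close>

definition offspring_gf_deriv :: "nat \<Rightarrow> (nat \<Rightarrow> real) \<Rightarrow> 'a \<Rightarrow> 'a::real_normed_field" where
  "offspring_gf_deriv D p s = (\<Sum>i\<le>D. of_real (p i) * (of_nat i * s ^ (i - 1)))"

lemma has_field_derivative_offspring_gf:
  "(offspring_gf D p has_field_derivative offspring_gf_deriv D p s) (at s)"
  unfolding offspring_gf_def[abs_def] offspring_gf_deriv_def
  by (auto intro!: derivative_eq_intros sum.cong)

lemma has_field_derivative_funpow_offspring_gf:
  "((offspring_gf D p ^^ n) has_field_derivative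
     (\<Prod>j<n. offspring_gf_deriv D p ((offspring_gf D p ^^ j) s))) (at s)"
proof (induction n)
  case (Suc n)
  show ?case
    using DERIV_chain[OF has_field_derivative_offspring_gf Suc]
    by (simp add: mult.commute o_def)
qed (simp add: id_def)

section \<open>Taylor expansions at the fixed point 1\<close>

lemma power_expansion_1:
  "\<exists>K\<ge>0. \<forall>x::complex. norm x \<le> 2 \<longrightarrow>
     norm ((1 - x) ^ i - (1 - of_nat i * x)) \<le> K * norm x ^ 2"
proof (induction i)
  case (Suc i)
  then obtain K where K: "K \<ge> 0"
    "\<And>x::complex. norm x \<le> 2 \<Longrightarrow> norm ((1 - x) ^ i - (1 - of_nat i * x)) \<le> K * norm x ^ 2"
    by blast
  have "norm ((1 - x) ^ Suc i - (1 - of_nat (Suc i) * x)) \<le> (3 * K + real i) * norm x ^ 2"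
    if x: "norm x \<le> 2" for x :: complex
  proof -
    let ?e = "(1 - x) ^ i - (1 - of_nat i * x)"
    have "(1 - x) ^ Suc i - (1 - of_nat (Suc i) * x) = (1 - x) * ?e + of_nat i * x ^ 2"
      \<comment> \<open>The old remainder is multiplied by \<open>1 - x\<close>, of norm at most 3,
        and the only new term is quadratic.\<close>
      by (simp add: algebra_simps power2_eq_square)
    also have "norm \<dots> \<le> norm (1 - x) * norm ?e + real i * norm x ^ 2"
      by (rule norm_triangle_le) (simp add: norm_mult norm_power)
    also have "\<dots> \<le> 3 * (K * norm x ^ 2) + real i * norm x ^ 2"
      using K(2)[OF x] norm_triangle_ineq4[of 1 x] x
      by (intro add_right_mono mult_mono) auto
    finally show ?thesis by (simp add: algebra_simps)
  qed
  then show ?case using K(1) by (intro exI[of _ "3 * K + real i"]) auto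
qed (auto intro: exI[of _ 0])

text \<open>Same induction one order higher. The disc of radius 2 contains every
  \<open>x = 1 - s\<close> with \<open>s\<close> in the closed unit disc.\<close>

lemma power_expansion_2:
  "\<exists>K\<ge>0. \<forall>x::complex. norm x \<le> 2 \<longrightarrow>
     norm ((1 - x) ^ i - (1 - of_nat i * x + of_nat i * (of_nat i - 1) / 2 * x ^ 2)) \<le> K * norm x ^ 3"
proof (induction i)
  case (Suc i)
  let ?c = "\<lambda>i. of_nat i * (of_nat i - 1) / 2 :: complex"
  obtain K where K: "K \<ge> 0"
    "\<And>x::complex. norm x \<le> 2 \<Longrightarrow>
       norm ((1 - x) ^ i - (1 - of_nat i * x + ?c i * x ^ 2)) \<le> K * norm x ^ 3"
    using Suc by blast
  have "norm ((1 - x) ^ Suc i - (1 - of_nat (Suc i) * x + ?c (Suc i) * x ^ 2))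
      \<le> (3 * K + norm (?c i)) * norm x ^ 3"
    if x: "norm x \<le> 2" for x :: complex
  proof -
    let ?e = "(1 - x) ^ i - (1 - of_nat i * x + ?c i * x ^ 2)"
    have "(1 - x) ^ Suc i - (1 - of_nat (Suc i) * x + ?c (Suc i) * x ^ 2)
        = (1 - x) * ?e - ?c i * x ^ 3"
      by (simp add: field_simps power2_eq_square power3_eq_cube)
    also have "norm \<dots> \<le> norm (1 - x) * norm ?e + norm (?c i) * norm x ^ 3"
      by (rule norm_triangle_le_diff) (simp add: norm_mult norm_power norm_divide)
    also have "\<dots> \<le> 3 * (K * norm x ^ 3) + norm (?c i) * norm x ^ 3"
      using K(2)[OF x] norm_triangle_ineq4[of 1 x] x
      by (intro add_right_mono mult_mono) auto
    finally show ?thesis by (simp add: algebra_simps)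
  qed
  then show ?case using K(1) by (intro exI[of _ "3 * K + norm (?c i)"]) auto
qed (auto intro: exI[of _ 0])

text \<open>The exponentially tilted minimizer has full support. Positivity of \<open>p 1\<close>
  links consecutive tree sizes; positivity of \<open>p 2\<close> yields positive variance and almost
  sure extinction.\<close>

locale critical_offspring =
  fixes D :: nat and p :: "nat \<Rightarrow> real"
  assumes D_ge_2: "2 \<le> D"
    and p_pos: "i \<le> D \<Longrightarrow> 0 < p i"
    and p_sum: "(\<Sum>i\<le>D. p i) = 1"
    and p_mean: "(\<Sum>i\<le>D. real i * p i) = 1"
begin

abbreviation "\<mu> \<equiv> offspring_variance D p"
abbreviation "\<phi> \<equiv> offspring_gf D p"
abbreviation "\<phi>' \<equiv> offspring_gf_deriv D p"

lemma p_nonneg: "i \<le> D \<Longrightarrow> 0 \<le> p i"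
  using p_pos[of i] by simp

text \<open>This is the second derivative of the generating function at 1; mean one turns it into
  the variance.\<close>

lemma factorial_moment: "(\<Sum>i\<le>D. p i * (real i * (real i - 1))) = \<mu>"
proof -
  have "(\<Sum>i\<le>D. p i * (real i * (real i - 1))) = (\<Sum>i\<le>D. (real i)\<^sup>2 * p i) - (\<Sum>i\<le>D. real i * p i)"
    unfolding sum_subtractf[symmetric] by (intro sum.cong) (auto simp: algebra_simps power2_eq_square)
  then show ?thesis by (simp add: offspring_variance_def p_mean)
qed

lemma variance_pos: "\<mu> > 0"
proof -
  have "p 2 * (real 2 * (real 2 - 1)) \<le> (\<Sum>i\<le>D. p i * (real i * (real i - 1)))"
  proof (rule member_le_sum)
    show "0 \<le> p i * (real i * (real i - 1))" if "i \<in> {..D} - {2}" for i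
      using p_nonneg[of i] that by (cases i) auto
  qed (use D_ge_2 in auto)
  then show ?thesis using p_pos[of 2] D_ge_2 by (simp add: factorial_moment)
qed

lemma sum_weighted_bound:
  fixes f g :: "nat \<Rightarrow> 'b::real_normed_field"
  assumes "\<And>i. i \<le> D \<Longrightarrow> norm (f i) \<le> B i"
  shows "norm (\<Sum>i\<le>D. of_real (p i) * f i) \<le> (\<Sum>i\<le>D. p i * B i)"
  using assms p_nonneg
  by (intro sum_norm_le) (auto simp: norm_mult intro!: mult_left_mono)

lemma norm_gf_le: "norm s \<le> 1 \<Longrightarrow> norm (\<phi> s) \<le> 1" for s :: "'a::real_normed_field"
  using sum_weighted_bound[of "\<lambda>i. s ^ i" "\<lambda>_. 1"]
  by (simp add: offspring_gf_def norm_power power_le_one p_sum)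

lemma norm_gf_deriv_le: "norm s \<le> 1 \<Longrightarrow> norm (\<phi>' s) \<le> 1" for s :: complex
  using sum_weighted_bound[of "\<lambda>i. of_nat i * s ^ (i - 1)" "\<lambda>i. real i"] p_mean
  by (simp add: offspring_gf_deriv_def norm_mult norm_power power_le_one mult_left_le mult.commute)

lemma one_minus_gf: "1 - \<phi> s = (\<Sum>i\<le>D. of_real (p i) * (1 - s ^ i))"
  by (simp add: offspring_gf_def right_diff_distrib sum_subtractf p_sum flip: of_real_sum)

text \<open>Each power satisfies \<open>norm (1 - s ^ i) \<le> i * norm (1 - s)\<close>, and
  averaging uses mean one. Thus the iterates never move away from the fixed point 1.\<close>

lemma norm_one_minus_gf_le: "norm s \<le> 1 \<Longrightarrow> norm (1 - \<phi> s) \<le> norm (1 - s)" for s :: "'a::real_normed_field"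
proof -
  assume s: "norm s \<le> 1"
  have "norm (1 - s ^ i) \<le> real i * norm (1 - s)" for i
    using norm_power_diff[of 1 s i] s by simp
  then have "norm (1 - \<phi> s) \<le> (\<Sum>i\<le>D. p i * (real i * norm (1 - s)))"
    unfolding one_minus_gf by (rule sum_weighted_bound)
  also have "\<dots> = (\<Sum>i\<le>D. real i * p i) * norm (1 - s)"
    by (simp add: sum_distrib_left sum_distrib_right mult_ac)
  finally show ?thesis by (simp add: p_mean)
qed

lemma funpow_gf_bounds:
  fixes s :: "'a::real_normed_field"
  assumes "norm s \<le> 1"
  shows "norm ((\<phi> ^^ n) s) \<le> 1" "norm (1 - (\<phi> ^^ n) s) \<le> norm (1 - s)"
proof (induction n)
  case (Suc n)
  {
    case 1 then show ?case using norm_gf_le[OF Suc.IH(1)] by simp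
  next
    case 2 then show ?case using norm_one_minus_gf_le[OF Suc.IH(1)] Suc.IH(2) by simp
  }
qed (use assms in auto)

text \<open>Average the second-order expansions of the powers with weights \<open>p i\<close>: the
  coefficients become the total mass, the mean and half the factorial moment.\<close>

lemma gf_expansion:
  "\<exists>K\<ge>0. \<forall>x::complex. norm x \<le> 2 \<longrightarrow>
     norm (1 - \<phi> (1 - x) - (x - of_real (\<mu> / 2) * x ^ 2)) \<le> K * norm x ^ 3"
proof -
  let ?t = "\<lambda>i (x::complex). 1 - of_nat i * x + of_nat i * (of_nat i - 1) / 2 * x ^ 2"
  obtain K where K: "\<And>i. K i \<ge> 0"
    "\<And>i x. norm x \<le> 2 \<Longrightarrow> norm ((1 - x) ^ i - ?t i x) \<le> K i * norm x ^ 3"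
    using power_expansion_2 by metis
  have "norm (1 - \<phi> (1 - x) - (x - of_real (\<mu> / 2) * x ^ 2)) \<le> (\<Sum>i\<le>D. p i * K i) * norm x ^ 3"
    if x: "norm x \<le> 2" for x :: complex
  proof -
    have "(\<Sum>i\<le>D. of_real (p i) * ?t i x) =
        of_real (\<Sum>i\<le>D. p i) - of_real (\<Sum>i\<le>D. real i * p i) * x
          + of_real (\<Sum>i\<le>D. p i * (real i * (real i - 1))) / 2 * x ^ 2"
      unfolding of_real_sum sum_distrib_right sum_divide_distrib
        sum_subtractf[symmetric] sum.distrib[symmetric]
      by (intro sum.cong refl) (simp add: algebra_simps add_divide_distrib diff_divide_distrib)
    also have "\<dots> = 1 - x + of_real (\<mu> / 2) * x ^ 2"
      by (simp only: p_sum p_mean factorial_moment) simp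
    finally have "(\<Sum>i\<le>D. of_real (p i) * ((1 - x) ^ i - ?t i x)) =
        - (1 - \<phi> (1 - x) - (x - of_real (\<mu> / 2) * x ^ 2))"
      by (simp only: right_diff_distrib sum_subtractf) (simp add: offspring_gf_def)
    then have "norm (1 - \<phi> (1 - x) - (x - of_real (\<mu> / 2) * x ^ 2)) =
        norm (\<Sum>i\<le>D. of_real (p i) * ((1 - x) ^ i - ?t i x))"
      by (simp only: norm_minus_cancel)
    also have "\<dots> \<le> (\<Sum>i\<le>D. p i * (K i * norm x ^ 3))"
      by (rule sum_weighted_bound) (rule K(2)[OF x])
    finally show ?thesis by (simp add: sum_distrib_right mult.assoc)
  qed
  then show ?thesis
    using K(1) p_nonneg by (intro exI[of _ "\<Sum>i\<le>D. p i * K i"]) (auto intro!: sum_nonneg)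
qed

lemma gf_deriv_expansion:
  "\<exists>K\<ge>0. \<forall>x::complex. norm x \<le> 2 \<longrightarrow> norm (\<phi>' (1 - x) - (1 - of_real \<mu> * x)) \<le> K * norm x ^ 2"
proof -
  let ?t = "\<lambda>i (x::complex). of_nat i * (1 - (of_nat i - 1) * x)"
  obtain K where K: "\<And>i. K i \<ge> 0"
    "\<And>i (x::complex). norm x \<le> 2 \<Longrightarrow> norm ((1 - x) ^ i - (1 - of_nat i * x)) \<le> K i * norm x ^ 2"
    using power_expansion_1 by metis
  have "norm (\<phi>' (1 - x) - (1 - of_real \<mu> * x)) \<le> (\<Sum>i\<le>D. p i * (real i * K (i - 1))) * norm x ^ 2"
    if x: "norm x \<le> 2" for x :: complex
  proof -
    have "(\<Sum>i\<le>D. of_real (p i) * ?t i x) =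
        of_real (\<Sum>i\<le>D. real i * p i) - of_real (\<Sum>i\<le>D. p i * (real i * (real i - 1))) * x"
      unfolding of_real_sum sum_distrib_right sum_subtractf[symmetric]
      by (intro sum.cong refl) (simp add: algebra_simps)
    also have "\<dots> = 1 - of_real \<mu> * x"
      by (simp only: p_mean factorial_moment) simp
    finally have "norm (\<phi>' (1 - x) - (1 - of_real \<mu> * x)) =
        norm (\<Sum>i\<le>D. of_real (p i) * (of_nat i * (1 - x) ^ (i - 1) - ?t i x))"
      by (simp only: right_diff_distrib[of "of_real _"] sum_subtractf) (simp add: offspring_gf_deriv_def)
    also have "\<dots> \<le> (\<Sum>i\<le>D. p i * (real i * (K (i - 1) * norm x ^ 2)))"
    proof (rule sum_weighted_bound)
      fix i
      \<comment> \<open>The case split covers \<open>i = 0\<close>, where \<open>i - 1\<close> is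
        truncated and both sides vanish.\<close>
      have "of_nat i * (1 - x) ^ (i - 1) - ?t i x =
          of_nat i * ((1 - x) ^ (i - 1) - (1 - of_nat (i - 1) * x))"
        by (cases i) (auto simp: algebra_simps)
      then show "norm (of_nat i * (1 - x) ^ (i - 1) - ?t i x) \<le> real i * (K (i - 1) * norm x ^ 2)"
        using K(2)[OF x, of "i - 1"] by (simp add: norm_mult mult_left_mono)
    qed
    finally show ?thesis by (simp add: sum_distrib_right mult.assoc)
  qed
  then show ?thesis
    using K(1) p_nonneg
    by (intro exI[of _ "\<Sum>i\<le>D. p i * (real i * K (i - 1))"]) (auto intro!: sum_nonneg)
qed

text \<open>In the coordinate \<open>x = 1 - s\<close> one step is
  \<open>x - (\<mu> / 2) x^2 + O(x^3)\<close>, so on reciprocals it is nearly a translation by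
  \<open>\<mu> / 2\<close>. The derivative \<open>1 - \<mu> x + O(x^2)\<close> agrees to first order
  with the square of the ratio of successive values, and such ratios telescope along an
  orbit.\<close>

lemma gf_fixed_point_step:
  "\<exists>K\<ge>0. \<exists>\<delta>>0. \<forall>x::complex. x \<noteq> 0 \<longrightarrow> norm x \<le> \<delta> \<longrightarrow>
     1 - \<phi> (1 - x) \<noteq> 0 \<and>
     norm (1 / (1 - \<phi> (1 - x)) - 1 / x - of_real (\<mu> / 2)) \<le> K * norm x \<and>
     norm (\<phi>' (1 - x) - ((1 - \<phi> (1 - x)) / x) ^ 2) \<le> K * norm x ^ 2"
proof -
  obtain K1 where K1: "K1 \<ge> 0" "\<And>x::complex. norm x \<le> 2 \<Longrightarrow>
      norm (1 - \<phi> (1 - x) - (x - of_real (\<mu> / 2) * x ^ 2)) \<le> K1 * norm x ^ 3"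
    using gf_expansion by blast
  obtain K2 where K2: "K2 \<ge> 0" "\<And>x::complex. norm x \<le> 2 \<Longrightarrow>
      norm (\<phi>' (1 - x) - (1 - of_real \<mu> * x)) \<le> K2 * norm x ^ 2"
    using gf_deriv_expansion by blast
  define m where "m = \<mu> / 2"
  have m: "m > 0" using variance_pos by (simp add: m_def)
  \<comment> \<open>The second bound keeps the ratio \<open>\<rho>\<close> of successive values
    within 1/2 of 1. Hence \<open>norm \<rho> \<ge> 1 / 2\<close>, the source of the factor 2 in
    \<open>A\<close>; \<open>B\<close> adds the derivative remainder to the error of squaring
    \<open>1 - m x + e\<close>.\<close>
  define \<delta> where "\<delta> = min 1 (1 / (2 * (m + K1)))"
  define A where "A = 2 * (m * (m + K1) + K1)"
  define B where "B = K2 + (m ^ 2 + 2 * (1 + m) * K1 + K1 ^ 2)"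
  have bounds: "1 - \<phi> (1 - x) \<noteq> 0 \<and>
     norm (1 / (1 - \<phi> (1 - x)) - 1 / x - of_real m) \<le> max A B * norm x \<and>
     norm (\<phi>' (1 - x) - ((1 - \<phi> (1 - x)) / x) ^ 2) \<le> max A B * norm x ^ 2"
    if x: "x \<noteq> 0" "norm x \<le> \<delta>" for x :: complex
  proof -
    have x1: "norm x \<le> 1" "norm x \<le> 2" "norm x ^ 2 \<le> norm x"
      using x by (auto simp: \<delta>_def power2_eq_square intro: mult_left_le)
    define \<rho> where "\<rho> = (1 - \<phi> (1 - x)) / x"
    define e where "e = \<rho> - (1 - of_real m * x)"
    have \<psi>: "1 - \<phi> (1 - x) = x * \<rho>" using x by (simp add: \<rho>_def)
    have "1 - \<phi> (1 - x) - (x - of_real (\<mu> / 2) * x ^ 2) = x * e"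
      unfolding \<psi> e_def m_def by (simp add: algebra_simps power2_eq_square)
    then have "norm x * norm e \<le> norm x * (K1 * norm x ^ 2)"
      using K1(2)[OF x1(2)] by (simp add: norm_mult power3_eq_cube power2_eq_square mult_ac)
    then have e: "norm e \<le> K1 * norm x ^ 2" using x by simp
    then have e1: "norm e \<le> K1 * norm x" "norm e \<le> K1"
      using x1 K1(1) by (meson mult_left_mono mult_left_le order_trans zero_le_power2)+
    have "norm (1 - \<rho>) = norm (of_real m * x - e)" by (simp add: e_def)
    also have "\<dots> \<le> m * norm x + norm e"
      using m by (intro norm_triangle_le_diff) (simp add: norm_mult)
    finally have \<rho>1: "norm (1 - \<rho>) \<le> (m + K1) * norm x" using e1(1) by (simp add: algebra_simps)
    also have "(m + K1) * norm x \<le> 1 / 2"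
      using x(2) m K1(1) by (simp add: \<delta>_def field_simps)
    finally have "norm (1 - \<rho>) \<le> 1 / 2" .
    then have \<rho>: "norm \<rho> \<ge> 1 / 2" using norm_triangle_ineq2[of 1 "1 - \<rho>"] by simp
    then have \<rho>0: "\<rho> \<noteq> 0" by auto
    \<comment> \<open>The first-order terms cancel because
      \<open>1 - \<rho> = m x - e\<close>.\<close>
    have "1 / (x * \<rho>) - 1 / x - of_real m = (of_real m * x * (1 - \<rho>) - e) / (x * \<rho>)"
      using x \<rho>0 by (simp add: e_def field_simps)
    also have "norm \<dots> = norm (of_real m * x * (1 - \<rho>) - e) / (norm x * norm \<rho>)"
      by (simp add: norm_divide norm_mult)
    also have "\<dots> \<le> (m * norm x * ((m + K1) * norm x) + K1 * norm x ^ 2) / (norm x * (1 / 2))"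
    proof (rule frac_le)
      have "norm (of_real m * x * (1 - \<rho>) - e) \<le> m * norm x * norm (1 - \<rho>) + norm e"
        using m by (intro norm_triangle_le_diff) (simp add: norm_mult)
      also have "\<dots> \<le> m * norm x * ((m + K1) * norm x) + K1 * norm x ^ 2"
        using e \<rho>1 m by (intro add_mono mult_left_mono) auto
      finally show "norm (of_real m * x * (1 - \<rho>) - e) \<le>
          m * norm x * ((m + K1) * norm x) + K1 * norm x ^ 2" .
      show "norm x * (1 / 2) \<le> norm x * norm \<rho>" using \<rho> by (intro mult_left_mono) auto
    qed (use x m K1 in auto)
    also have "\<dots> = A * norm x"
      using x by (simp add: A_def field_simps power2_eq_square)
    finally have r1: "norm (1 / (x * \<rho>) - 1 / x - of_real m) \<le> A * norm x" .
    have "\<phi>' (1 - x) - \<rho> ^ 2 = (\<phi>' (1 - x) - (1 - of_real \<mu> * x)) -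
        ((of_real m * x) ^ 2 + 2 * (1 - of_real m * x) * e + e ^ 2)"
    proof -
      have "complex_of_real \<mu> = 2 * of_real m" by (simp add: m_def)
      then show ?thesis by (simp add: e_def algebra_simps power2_eq_square)
    qed
    also have "norm \<dots> \<le> K2 * norm x ^ 2 +
        (m ^ 2 * norm x ^ 2 + 2 * (1 + m) * (K1 * norm x ^ 2) + K1 * (K1 * norm x ^ 2))"
    proof -
      have 1: "norm (\<phi>' (1 - x) - (1 - of_real \<mu> * x)) \<le> K2 * norm x ^ 2" using K2(2)[OF x1(2)] .
      have 2: "norm ((of_real m * x) ^ 2) \<le> m ^ 2 * norm x ^ 2"
        by (simp add: norm_mult norm_power power_mult_distrib)
      have "m * norm x \<le> m" using m x1(1) by (intro mult_left_le) auto
      moreover have "norm (1 - of_real m * x) \<le> 1 + m * norm x"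
        using norm_triangle_ineq4[of 1 "of_real m * x"] m by (simp add: norm_mult)
      ultimately have "norm (1 - of_real m * x) \<le> 1 + m" by linarith
      then have "norm (1 - of_real m * x) * norm e \<le> (1 + m) * (K1 * norm x ^ 2)"
        using e m by (intro mult_mono) auto
      then have 3: "norm (2 * (1 - of_real m * x) * e) \<le> 2 * (1 + m) * (K1 * norm x ^ 2)"
        by (simp only: norm_mult norm_numeral mult.assoc mult_le_cancel_left_pos[OF zero_less_numeral])
      have "norm e * norm e \<le> K1 * (K1 * norm x ^ 2)"
        using e e1 K1(1) by (intro mult_mono) auto
      then have 4: "norm (e ^ 2) \<le> K1 * (K1 * norm x ^ 2)"
        by (simp add: norm_mult power2_eq_square)
      show ?thesis
        by (rule norm_triangle_le_diff[OF add_mono[OF 1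
              norm_triangle_le[OF add_mono[OF norm_triangle_le[OF add_mono[OF 2 3]] 4]]]])
    qed
    also have "\<dots> = B * norm x ^ 2" by (simp add: B_def algebra_simps power2_eq_square)
    finally have r2: "norm (\<phi>' (1 - x) - \<rho> ^ 2) \<le> B * norm x ^ 2" .
    have "A * norm x \<le> max A B * norm x" "B * norm x ^ 2 \<le> max A B * norm x ^ 2"
      by (intro mult_right_mono; simp)+
    with r1 r2 have "norm (1 / (x * \<rho>) - 1 / x - of_real m) \<le> max A B * norm x"
      "norm (\<phi>' (1 - x) - \<rho> ^ 2) \<le> max A B * norm x ^ 2"
      by (auto intro: order_trans)
    then show ?thesis unfolding \<psi> using \<rho>0 x by simp
  qed
  have "max A B \<ge> 0" "\<delta> > 0" using m K1(1) by (auto simp: A_def \<delta>_def le_max_iff_disj)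
  then show ?thesis using bounds unfolding m_def by blast
qed


text \<open>Let \<open>x n j\<close> be the distance vector from 1 after \<open>j\<close> steps.
  Adding up the near-translations gives \<open>1 / x n n\<close> close to
  \<open>1 / x n 0 + n \<mu> / 2\<close>, which determines the limit of
  \<open>q n = x n n / x n 0\<close>. The product of derivatives is close to the telescoping product
  of squared ratios, that is, to \<open>q n ^ 2\<close>.\<close>

lemma gf_funpow_asymp:
  fixes s :: "nat \<Rightarrow> complex"
  assumes norm_s: "\<And>n. norm (s n) \<le> 1"
    and lim: "(\<lambda>n. of_nat n * (1 - s n)) \<longlonglongrightarrow> a"
    and a_nz: "a \<noteq> 0" and a: "1 + a * of_real (\<mu> / 2) \<noteq> 0"
  shows "(\<lambda>n. \<Prod>j<n. \<phi>' ((\<phi> ^^ j) (s n))) \<longlonglongrightarrow> 1 / (1 + a * of_real (\<mu> / 2)) ^ 2"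
proof -
  obtain K \<delta> where K: "K \<ge> 0" "\<delta> > 0"
    and nz: "\<And>x::complex. x \<noteq> 0 \<Longrightarrow> norm x \<le> \<delta> \<Longrightarrow> 1 - \<phi> (1 - x) \<noteq> 0"
    and step: "\<And>x::complex. x \<noteq> 0 \<Longrightarrow> norm x \<le> \<delta> \<Longrightarrow>
       norm (1 / (1 - \<phi> (1 - x)) - 1 / x - of_real (\<mu> / 2)) \<le> K * norm x"
    and deriv: "\<And>x::complex. x \<noteq> 0 \<Longrightarrow> norm x \<le> \<delta> \<Longrightarrow>
       norm (\<phi>' (1 - x) - ((1 - \<phi> (1 - x)) / x) ^ 2) \<le> K * norm x ^ 2"
    using gf_fixed_point_step by metis
  define d where "d n = norm (1 - s n)" for n
  define x where "x n j = 1 - (\<phi> ^^ j) (s n)" for n j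
  have x_Suc: "x n (Suc j) = 1 - \<phi> (1 - x n j)" for n j by (simp add: x_def)
  have x_le: "norm (x n j) \<le> d n" for n j
    unfolding x_def d_def by (rule funpow_gf_bounds(2)[OF norm_s])
  have lim_nd: "(\<lambda>n. real n * d n) \<longlonglongrightarrow> norm a"
    using tendsto_norm[OF lim] by (simp add: d_def norm_mult)
  have lim_d: "d \<longlonglongrightarrow> 0"
  proof -
    have "(\<lambda>n. 1 / real n * (real n * d n)) \<longlonglongrightarrow> 0 * norm a"
      by (intro tendsto_mult lim_nd lim_1_over_n)
    moreover have "\<forall>\<^sub>F n in sequentially. 1 / real n * (real n * d n) = d n"
      using eventually_gt_at_top[of 0] by eventually_elim simp
    ultimately show ?thesis by (simp add: tendsto_cong)
  qed
  \<comment> \<open>This bounds both accumulated errors: \<open>n\<close> reciprocal steps of error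
    \<open>K * d n\<close>, rescaled by \<open>norm (x n 0) = d n\<close>, and \<open>n\<close>
    derivative factors of error \<open>K * (d n)^2\<close>. It vanishes since \<open>n * d n\<close>
    converges.\<close>
  have lim_ndd: "(\<lambda>n. K * (real n * d n * d n)) \<longlonglongrightarrow> 0"
    using tendsto_mult[OF tendsto_const tendsto_mult[OF lim_nd lim_d], of K] by simp
  have small: "\<forall>\<^sub>F n in sequentially. s n \<noteq> 1 \<and> d n \<le> \<delta>"
    using order_tendstoD(2)[OF lim_d K(2)] tendsto_imp_eventually_ne[OF lim a_nz]
    by eventually_elim auto
  have x_nz: "x n j \<noteq> 0" if "s n \<noteq> 1" "d n \<le> \<delta>" for n j
  proof (induction j)
    case (Suc j)
    then show ?case using nz[of "x n j"] x_le[of n j] that by (simp add: x_Suc)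
  qed (use that(1) in \<open>simp add: x_def\<close>)
  have inv: "norm (1 / x n m - 1 / x n 0 - of_nat m * of_real (\<mu> / 2)) \<le> real m * (K * d n)"
    if n: "s n \<noteq> 1" "d n \<le> \<delta>" for n m
  proof (induction m)
    case (Suc m)
    have "norm (1 / x n (Suc m) - 1 / x n m - of_real (\<mu> / 2)) \<le> K * norm (x n m)"
      unfolding x_Suc using x_nz[OF n] x_le[of n m] n by (intro step) auto
    also have "\<dots> \<le> K * d n" using x_le K(1) by (rule mult_left_mono)
    finally have "norm (1 / x n (Suc m) - 1 / x n m - of_real (\<mu> / 2)) \<le> K * d n" .
    from norm_triangle_mono[OF this Suc] show ?case
      by (simp add: algebra_simps add_divide_distrib)
  qed simp
  define q where "q n = x n n / x n 0" for n
  have lim_q: "q \<longlonglongrightarrow> 1 / (1 + a * of_real (\<mu> / 2))"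
  proof -
    have "(\<lambda>n. 1 / q n - (1 + of_nat n * (1 - s n) * of_real (\<mu> / 2))) \<longlonglongrightarrow> 0"
    proof (rule Lim_null_comparison[OF _ lim_ndd])
      show "\<forall>\<^sub>F n in sequentially. norm (1 / q n - (1 + of_nat n * (1 - s n) * of_real (\<mu> / 2)))
          \<le> K * (real n * d n * d n)"
        using small
      proof eventually_elim
        case (elim n)
        have "1 / q n - (1 + of_nat n * (1 - s n) * of_real (\<mu> / 2)) =
            x n 0 * (1 / x n n - 1 / x n 0 - of_nat n * of_real (\<mu> / 2))"
        proof -
          have "1 - s n = x n 0" by (simp add: x_def)
          then show ?thesis
            using x_nz[of n 0] elim by (simp add: q_def right_diff_distrib del: diff_eq_eq)
        qed
        also have "norm \<dots> \<le> d n * (real n * (K * d n))"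
          unfolding norm_mult using x_le inv elim by (intro mult_mono) (auto simp: d_def)
        finally show ?case by (simp add: mult_ac)
      qed
    qed
    moreover have "(\<lambda>n. 1 + of_nat n * (1 - s n) * of_real (\<mu> / 2)) \<longlonglongrightarrow> 1 + a * of_real (\<mu> / 2)"
      by (intro tendsto_intros lim)
    ultimately have "(\<lambda>n. 1 / q n) \<longlonglongrightarrow> 1 + a * of_real (\<mu> / 2)"
      by (rule Lim_transform[rotated])
    from tendsto_divide[OF tendsto_const this a, of 1] show ?thesis by simp
  qed
  have "(\<lambda>n. (\<Prod>j<n. \<phi>' ((\<phi> ^^ j) (s n))) - q n ^ 2) \<longlonglongrightarrow> 0"
  proof (rule Lim_null_comparison[OF _ lim_ndd])
    show "\<forall>\<^sub>F n in sequentially. norm ((\<Prod>j<n. \<phi>' ((\<phi> ^^ j) (s n))) - q n ^ 2)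
        \<le> K * (real n * d n * d n)"
      using small
    proof eventually_elim
      case (elim n)
      have ratio: "norm (x n (Suc j) / x n j) \<le> 1" for j
      proof -
        have "norm (x n (Suc j)) \<le> norm (x n j)"
          using norm_one_minus_gf_le[OF funpow_gf_bounds(1)[OF norm_s, of j n]] by (simp add: x_def)
        then show ?thesis by (simp add: norm_divide divide_le_eq_1)
      qed
      have telescope: "(\<Prod>j<m. x n (Suc j) / x n j) = x n m / x n 0" for m
        using x_nz[of n] elim by (induction m) auto
      have "q n ^ 2 = (\<Prod>j<n. (x n (Suc j) / x n j) ^ 2)"
        by (simp only: q_def telescope[symmetric] prod_power_distrib)
      \<comment> \<open>All factors lie in the closed unit disc, so the difference of the products
        is at most the sum of the differences of the factors.\<close>
      then have "norm ((\<Prod>j<n. \<phi>' ((\<phi> ^^ j) (s n))) - q n ^ 2) \<le>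
          (\<Sum>j<n. norm (\<phi>' ((\<phi> ^^ j) (s n)) - (x n (Suc j) / x n j) ^ 2))"
        using ratio norm_gf_deriv_le[OF funpow_gf_bounds(1)[OF norm_s]]
        by (simp only:) (intro norm_prod_diff, auto simp: norm_power power_le_one)
      also have "\<dots> \<le> (\<Sum>j<n. K * (d n * d n))"
      proof (rule sum_mono)
        fix j
        have "norm (\<phi>' (1 - x n j) - (x n (Suc j) / x n j) ^ 2) \<le> K * norm (x n j) ^ 2"
          unfolding x_Suc using x_nz[of n j] x_le[of n j] elim by (intro deriv) auto
        also have "\<dots> \<le> K * (d n * d n)"
          unfolding power2_eq_square using x_le[of n j] K(1)
          by (intro mult_left_mono mult_mono) (auto simp: d_def)
        finally show "norm (\<phi>' ((\<phi> ^^ j) (s n)) - (x n (Suc j) / x n j) ^ 2) \<le> K * (d n * d n)"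
          by (simp add: x_def)
      qed
      finally show ?case by (simp add: mult_ac)
    qed
  qed
  from tendsto_add[OF this tendsto_power[OF lim_q, of 2]] show ?thesis
    by (simp add: power_divide)
qed

text \<open>The iterates from 0 increase and are bounded by 1; a gap \<open>p 2 * (1 - s)^2\<close>
  between \<open>\<phi> s\<close> and \<open>s\<close> forces their limit to be 1.\<close>

lemma extinction_tendsto: "(\<lambda>n. (\<phi> ^^ n) (0::real)) \<longlonglongrightarrow> 1"
proof -
  define a where "a n = (\<phi> ^^ n) (0::real)" for n
  have gf_le: "\<phi> s \<le> 1" if "0 \<le> s" "s \<le> 1" for s :: real
  proof -
    have "\<phi> s \<le> (\<Sum>i\<le>D. p i * 1)"
      unfolding offspring_gf_def using that p_nonneg
      by (intro sum_mono) (auto simp: power_le_one intro!: mult_left_le)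
    then show ?thesis by (simp add: p_sum)
  qed
  have gf_ge: "s + p 2 * (1 - s) ^ 2 \<le> \<phi> s" if "0 \<le> s" "s \<le> 1" for s :: real
  proof -
    \<comment> \<open>By mean one, \<open>\<phi> s - s\<close> is the weighted sum of these
      Bernoulli defects. They are nonnegative, and the one for \<open>i = 2\<close> equals
      \<open>(1 - s)^2\<close>.\<close>
    have nonneg: "0 \<le> s ^ i - (1 + real i * (s - 1))" for i
      using Bernoulli_inequality[of "s - 1" i] that by simp
    have "p 2 * (1 - s) ^ 2 = p 2 * (s ^ 2 - (1 + real 2 * (s - 1)))"
      by (simp add: power2_eq_square algebra_simps)
    also have "\<dots> \<le> (\<Sum>i\<le>D. p i * (s ^ i - (1 + real i * (s - 1))))"
      using p_nonneg nonneg D_ge_2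
      by (intro member_le_sum[where f = "\<lambda>i. p i * (s ^ i - (1 + real i * (s - 1)))"]) auto
    also have "\<dots> = (\<Sum>i\<le>D. p i * s ^ i - p i - real i * p i * (s - 1))"
      by (intro sum.cong) (auto simp: algebra_simps)
    also have "\<dots> = \<phi> s - s"
      by (simp only: sum_subtractf sum_distrib_right[symmetric] p_sum p_mean offspring_gf_def) simp
    finally show ?thesis by simp
  qed
  have a: "0 \<le> a n \<and> a n \<le> 1" for n
  proof (induction n)
    case (Suc n)
    have "0 \<le> p 2 * (1 - a n) ^ 2" using p_nonneg D_ge_2 by auto
    then have "0 \<le> \<phi> (a n)" using gf_ge[of "a n"] Suc by linarith
    then show ?case using gf_le[of "a n"] Suc by (simp add: a_def)
  qed (simp add: a_def)
  have incr: "a n + p 2 * (1 - a n) ^ 2 \<le> a (Suc n)" for n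
    using gf_ge[of "a n"] a[of n] by (simp add: a_def)
  have "a n \<le> a (Suc n)" for n
  proof -
    have "0 \<le> p 2 * (1 - a n) ^ 2" using p_nonneg D_ge_2 by auto
    then show ?thesis using incr[of n] by linarith
  qed
  then have "incseq a" by (rule incseq_SucI)
  then obtain L where L: "a \<longlonglongrightarrow> L"
    using incseq_convergent[of a 1] a by blast
  have "L + p 2 * (1 - L) ^ 2 \<le> L"
  proof (rule LIMSEQ_le[OF _ LIMSEQ_Suc[OF L]])
    show "(\<lambda>n. a n + p 2 * (1 - a n) ^ 2) \<longlonglongrightarrow> L + p 2 * (1 - L) ^ 2"
      by (intro tendsto_intros L)
  qed (use incr in auto)
  then have "L = 1" using p_pos[of 2] D_ge_2 by (simp add: mult_le_0_iff)
  then show ?thesis using L by (simp add: a_def[abs_def])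
qed

lemma funpow_gf_1: "(\<phi> ^^ n) 1 = (1::'a::real_normed_field)"
proof (induction n)
  case (Suc n)
  then show ?case by (simp add: offspring_gf_def p_sum flip: of_real_sum)
qed simp

lemma gf_deriv_1: "\<phi>' 1 = (1::real)"
  using p_mean by (simp add: offspring_gf_deriv_def mult.commute)

end

section \<open>Trees conditioned on their size\<close>

context critical_offspring
begin

definition size_prob :: "nat \<Rightarrow> real" where
  "size_prob N = (\<Sum>T\<in>trees_of_size D N. tree_prob p T)"

definition size_trunc_prob :: "nat \<Rightarrow> vertex set \<Rightarrow> nat \<Rightarrow> real" where
  "size_trunc_prob n S N = (\<Sum>T\<in>{T \<in> trees_of_size D N. trunc n T = S}. tree_prob p T)"

lemma tree_prob_pos: "T \<in> trees D \<Longrightarrow> tree_prob p T > 0"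
  unfolding tree_prob_def by (intro prod_pos p_pos) (auto simp: trees_def)

lemma trunc_prob_pos: "T \<in> trees D \<Longrightarrow> trunc_prob p n T > 0"
  unfolding trunc_prob_def by (intro prod_pos p_pos) (auto simp: trees_def below_def)

lemma size_prob_pos: "N \<ge> 1 \<Longrightarrow> size_prob N > 0"
  unfolding size_prob_def using trees_of_size_nonempty[of D N] D_ge_2
  by (intro sum_pos tree_prob_pos finite_trees_of_size) (auto simp: trees_of_size_def)

text \<open>The finitely many trees of size \<open>N\<close> have bounded height, so their total
  weight is at most the probability of extinction before some generation, which is an iterate of
  \<open>\<phi>\<close> at 0.\<close>

lemma size_prob_le_1: "size_prob N \<le> 1"
proof -
  have "finite (\<Union>(trees_of_size D N))"
    by (rule finite_Union[OF finite_trees_of_size]) (simp add: trees_of_size_def)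
  then have "finite (length ` \<Union>(trees_of_size D N))" by (rule finite_imageI)
  then obtain h where "\<And>k. k \<in> length ` \<Union>(trees_of_size D N) \<Longrightarrow> k < h"
    using finite_nat_set_iff_bounded by metis
  then have "trees_of_size D N \<subseteq> trees_below D h"
    by (auto simp: trees_of_size_def trees_below_def)
  then have "size_prob N \<le> (\<Sum>T\<in>trees_below D h. tree_prob p T)"
    unfolding size_prob_def
    by (intro sum_mono2 finite_trees_below less_imp_le[OF tree_prob_pos]) (auto simp: trees_below_def)
  also have "\<dots> \<le> 1"
    using funpow_gf_bounds(1)[of "0::real" h] by (simp add: extinction_prob)
  finally show ?thesis .
qed

text \<open>If the root has a single child, the rest is an arbitrary tree with one vertex fewer.
  This relates the weights of consecutive sizes.\<close>

lemma size_trunc_prob_star_1: "size_trunc_prob 1 (star 1) (Suc N) = p 1 * size_prob N"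
proof -
  have star: "star 1 \<in> trees D" using D_ge_2 by (intro star_in_trees) simp
  have lev: "level 1 (star 1) = {[0]}" unfolding level_star by auto
  have tr: "trunc 1 (star 1) = star 1"
    using star trees_upto_1[of D] D_ge_2 by (intro trunc_upto[of _ D]) auto
  have below: "card (below 1 (star 1)) = 1"
  proof -
    have "below 1 (star 1) = {[]}" by (auto simp: below_def star_def)
    then show ?thesis by simp
  qed
  have sub: "trees_of_size D N \<subseteq> trees D" by (auto simp: trees_of_size_def)
  have fiber: "{T \<in> trees_of_size D (Suc N). trunc 1 T = star 1} =
      {T \<in> trees D. trunc 1 T = trunc 1 (star 1) \<and> (\<forall>v\<in>level 1 (star 1). subtree T v \<in> trees_of_size D N)}"
  proof -
    have "finite T \<and> card T = Suc N \<longleftrightarrow> subtree T [0] \<in> trees_of_size D N"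
      if T: "T \<in> trees D" "trunc 1 T = star 1" for T
    proof -
      have "[0] \<in> trunc 1 T" unfolding T(2) by (simp add: star_def)
      then have T0: "subtree T [0] \<in> trees D"
        using T by (intro subtree_in_trees) (auto simp: trunc_def)
      interpret grafting D 1 "star 1" "subtree T"
        by standard (use star T0 lev in auto)
      have g: "graft 1 (star 1) (subtree T) = T"
        using T tr by (intro graft_subtrees) auto
      have fin: "finite T \<longleftrightarrow> finite (subtree T [0])"
      proof
        assume "finite T"
        then show "finite (subtree T [0])"
          unfolding subtree_def by (rule finite_vimageI[of _ "(@) [0]", unfolded vimage_def]) (simp add: inj_def)
      qed (use finite_graft g lev in auto)
      then show ?thesis
        using card_graft g lev below T0 by (auto simp: trees_of_size_def)
    qed
    then show ?thesis unfolding tr lev by (auto simp: trees_of_size_def)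
  qed
  have "size_trunc_prob 1 (star 1) (Suc N) =
      (\<Sum>g\<in>PiE (level 1 (star 1)) (\<lambda>_. trees_of_size D N). tree_prob p (graft 1 (star 1) g))"
    unfolding size_trunc_prob_def fiber
    by (rule sum.reindex_bij_betw[symmetric], rule bij_betw_graft[OF star sub])
  also have "\<dots> = (\<Sum>g\<in>PiE (level 1 (star 1)) (\<lambda>_. trees_of_size D N).
      p 1 * (\<Prod>v\<in>level 1 (star 1). tree_prob p (g v)))"
  proof (rule sum.cong[OF refl])
    fix g assume g: "g \<in> PiE (level 1 (star 1)) (\<lambda>_. trees_of_size D N)"
    interpret grafting D 1 "star 1" g
      by standard (use star g in \<open>auto simp: trees_of_size_def PiE_iff\<close>)
    show "tree_prob p (graft 1 (star 1) g) = p 1 * (\<Prod>v\<in>level 1 (star 1). tree_prob p (g v))"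
      using g by (subst tree_prob_graft)
        (auto simp: trees_of_size_def PiE_iff trunc_prob_star simp del: One_nat_def)
  qed
  also have "\<dots> = p 1 * (\<Prod>v\<in>level 1 (star 1). \<Sum>T\<in>trees_of_size D N. tree_prob p T)"
    unfolding sum_distrib_left[symmetric]
    by (subst prod_sum_PiE) (simp_all add: lev finite_trees_of_size del: One_nat_def)
  finally show ?thesis by (simp add: lev size_prob_def del: One_nat_def)
qed

text \<open>Only those trees are counted in which one vertex \<open>v\<close> of generation
  \<open>n\<close> carries a large subtree while the subtrees at the other vertices have height
  below \<open>h\<close>. For large \<open>N\<close> the vertex \<open>v\<close> is determined by
  the tree, so nothing is counted twice.\<close>

lemma size_trunc_prob_ge:
  assumes S: "S \<in> trees_upto D n"
  shows "\<forall>\<^sub>F N in sequentially. trunc_prob p n S *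
      (\<Sum>v\<in>level n S. \<Sum>g\<in>PiE (level n S - {v}) (\<lambda>_. trees_below D h).
         (\<Prod>u\<in>level n S - {v}. tree_prob p (g u)) *
         size_prob (N - (card (below n S) + (\<Sum>u\<in>level n S - {v}. card (g u)))))
      \<le> size_trunc_prob n S N"
proof -
  define L where "L = level n S"
  define m where "m = card (below n S)"
  \<comment> \<open>A crude bound on the size of any single tree of height below
    \<open>h\<close>.\<close>
  define M where "M = (\<Sum>T\<in>trees_below D h. card T)"
  define c where "c v g = m + (\<Sum>u\<in>L - {v}. card (g u))" for v and g :: "vertex \<Rightarrow> vertex set"
  have tr: "S \<in> trees D" using S by (simp add: trees_upto_def)
  have L: "finite L" using finite_level[OF tr] by (simp add: L_def)
  have card_M: "card T \<le> M" if "T \<in> trees_below D h" for T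
    unfolding M_def using that finite_trees_below by (intro member_le_sum) auto
  have "trunc_prob p n S * (\<Sum>v\<in>L. \<Sum>g\<in>PiE (L - {v}) (\<lambda>_. trees_below D h).
         (\<Prod>u\<in>L - {v}. tree_prob p (g u)) * size_prob (N - c v g)) \<le> size_trunc_prob n S N"
    if N: "N > m + card L * M + M" for N
  proof -
    \<comment> \<open>Triples of the distinguished vertex, the small subtrees and the large one. The
      threshold on \<open>N\<close> leaves more than \<open>M\<close> vertices for the large
      subtree, so it is not in \<open>trees_below D h\<close>; it also makes the subtraction
      \<open>N - c v g\<close> exact.\<close>
    define I where "I = (SIGMA v:L. SIGMA g:PiE (L - {v}) (\<lambda>_. trees_below D h). trees_of_size D (N - c v g))"
    define \<Phi> where "\<Phi> = (\<lambda>(v, g, T). graft n S (g(v := T)))"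
    have I: "c v g + M < N" "finite T" "card T = N - c v g" "T \<in> trees D" "T \<notin> trees_below D h"
      "g(v := T) \<in> PiE L (\<lambda>_. trees D)" "\<And>u. u \<in> L \<Longrightarrow> finite ((g(v := T)) u)"
      if "(v, g, T) \<in> I" for v g T
    proof -
      from that have v: "v \<in> L" and g: "g \<in> PiE (L - {v}) (\<lambda>_. trees_below D h)"
        and T: "T \<in> trees_of_size D (N - c v g)" by (auto simp: I_def)
      have "(\<Sum>u\<in>L - {v}. card (g u)) \<le> card (L - {v}) * M"
        using g card_M by (intro sum_bounded_above[of _ _ M, simplified]) (auto simp: PiE_iff)
      also have "\<dots> \<le> card L * M" using L by (intro mult_right_mono card_mono) auto
      finally show *: "c v g + M < N" using N by (simp add: c_def)
      show T': "finite T" "card T = N - c v g" "T \<in> trees D" using T by (auto simp: trees_of_size_def)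
      show "T \<notin> trees_below D h" using card_M[of T] T' * by auto
      show "g(v := T) \<in> PiE L (\<lambda>_. trees D)"
        using g v T' by (auto simp: PiE_iff trees_below_def extensional_def)
      show "finite ((g(v := T)) u)" if "u \<in> L" for u
        using g T' that finite_tree_upto[of "g u" D h] by (auto simp: PiE_iff trees_below_upto)
    qed
    have graft: "tree_prob p (\<Phi> (v, g, T)) =
          trunc_prob p n S * ((\<Prod>u\<in>L - {v}. tree_prob p (g u)) * tree_prob p T)"
        "\<Phi> (v, g, T) \<in> {T \<in> trees_of_size D N. trunc n T = S}"
      if i: "(v, g, T) \<in> I" for v g T
    proof -
      have v: "v \<in> L" using i by (auto simp: I_def)
      interpret grafting D n S "g(v := T)"
        by standard (use tr I(6)[OF i] in \<open>auto simp: PiE_iff L_def\<close>)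
      have fin: "finite ((g(v := T)) u)" if "u \<in> level n S" for u
        using I(7)[OF i] that by (simp add: L_def)
      have upd: "(\<Prod>u\<in>L. tree_prob p ((g(v := T)) u)) = (\<Prod>u\<in>L - {v}. tree_prob p (g u)) * tree_prob p T"
        "(\<Sum>u\<in>L. card ((g(v := T)) u)) = (\<Sum>u\<in>L - {v}. card (g u)) + card T"
        by (simp_all add: prod.remove[OF L v] sum.remove[OF L v])
      show "tree_prob p (\<Phi> (v, g, T)) =
          trunc_prob p n S * ((\<Prod>u\<in>L - {v}. tree_prob p (g u)) * tree_prob p T)"
        using tree_prob_graft[OF fin] upd by (simp add: \<Phi>_def L_def)
      have "card (graft n S (g(v := T))) = N"
        using card_graft[OF fin] upd(2) I(1,3)[OF i] by (simp add: c_def m_def L_def)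
      then show "\<Phi> (v, g, T) \<in> {T \<in> trees_of_size D N. trunc n T = S}"
        using finite_graft[OF fin] graft_in_trees trunc_graft trunc_upto[OF S]
        by (simp add: \<Phi>_def trees_of_size_def)
    qed
    have inj: "inj_on \<Phi> I"
    proof (rule inj_onI)
      fix i i'
      assume I_i: "i \<in> I" "i' \<in> I" and \<Phi>_eq: "\<Phi> i = \<Phi> i'"
      obtain v g T v' g' T' where ii: "i = (v, g, T)" "i' = (v', g', T')"
        by (metis surj_pair)
      have i: "(v, g, T) \<in> I" "(v', g', T') \<in> I" and eq: "\<Phi> (v, g, T) = \<Phi> (v', g', T')"
        using I_i \<Phi>_eq unfolding ii .
      have upd: "g(v := T) = g'(v' := T')"
        using inj_onD[OF inj_on_graft[OF tr] _ I(6)[OF i(1), unfolded L_def] I(6)[OF i(2), unfolded L_def]]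
          eq by (simp add: \<Phi>_def)
      \<comment> \<open>Otherwise the large subtree at \<open>v\<close> would be one of the small
        subtrees of the second triple.\<close>
      have "v = v'"
      proof (rule ccontr)
        assume "v \<noteq> v'"
        then have "T = g' v" using fun_cong[OF upd, of v] by simp
        moreover have "g' v \<in> trees_below D h" using i \<open>v \<noteq> v'\<close> by (auto simp: I_def PiE_iff)
        ultimately show False using I(5)[OF i(1)] by simp
      qed
      moreover have "T = T'" using fun_cong[OF upd, of v] \<open>v = v'\<close> by simp
      moreover have "g = g'"
      proof (rule PiE_ext[of g "L - {v}" "\<lambda>_. trees_below D h"])
        show "g \<in> PiE (L - {v}) (\<lambda>_. trees_below D h)" "g' \<in> PiE (L - {v}) (\<lambda>_. trees_below D h)"
          using i \<open>v = v'\<close> by (auto simp: I_def)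
        show "g u = g' u" if "u \<in> L - {v}" for u
          using fun_cong[OF upd, of u] that \<open>v = v'\<close> by simp
      qed
      ultimately show "i = i'" using \<open>v = v'\<close> by (simp add: ii)
    qed
    have "trunc_prob p n S * (\<Sum>v\<in>L. \<Sum>g\<in>PiE (L - {v}) (\<lambda>_. trees_below D h).
         (\<Prod>u\<in>L - {v}. tree_prob p (g u)) * size_prob (N - c v g)) =
        (\<Sum>v\<in>L. \<Sum>g\<in>PiE (L - {v}) (\<lambda>_. trees_below D h). \<Sum>T\<in>trees_of_size D (N - c v g).
          trunc_prob p n S * ((\<Prod>u\<in>L - {v}. tree_prob p (g u)) * tree_prob p T))"
      by (simp add: size_prob_def sum_distrib_left)
    also have "\<dots> = (\<Sum>(v, g, T)\<in>I. trunc_prob p n S * ((\<Prod>u\<in>L - {v}. tree_prob p (g u)) * tree_prob p T))"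
      unfolding I_def using L
      by (simp add: sum.Sigma finite_trees_below finite_trees_of_size finite_PiE finite_SigmaI)
    also have "\<dots> = (\<Sum>i\<in>I. tree_prob p (\<Phi> i))"
      using graft(1) by (intro sum.cong) (auto split: prod.splits)
    also have "\<dots> = (\<Sum>T\<in>\<Phi> ` I. tree_prob p T)"
      by (simp add: sum.reindex[OF inj])
    also have "\<dots> \<le> size_trunc_prob n S N"
      unfolding size_trunc_prob_def
    proof (rule sum_mono2)
      show "\<Phi> ` I \<subseteq> {T \<in> trees_of_size D N. trunc n T = S}" using graft(2) by auto
      show "finite {T \<in> trees_of_size D N. trunc n T = S}" by (simp add: finite_trees_of_size)
    qed (auto simp: trees_of_size_def intro!: less_imp_le[OF tree_prob_pos])
    finally show ?thesis .
  qed
  then show ?thesis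
    unfolding L_def c_def m_def
    by (intro eventually_mono[OF eventually_gt_at_top]) auto
qed

end

section \<open>Identification of the local limit as a size-biased law\<close>

locale size_conditioned_limit = critical_offspring +
  fixes P :: "nat \<Rightarrow> vertex set pmf"
  assumes P_support: "n \<ge> 1 \<Longrightarrow> set_pmf (P n) \<subseteq> trees_upto D n"
    and P_limit: "n \<ge> 1 \<Longrightarrow>
      (\<lambda>N. size_trunc_prob n S N / size_prob N) \<longlonglongrightarrow> pmf (P n) S"
begin

text \<open>The limit of \<open>size_prob N / size_prob (Suc N)\<close>, read off from the event
  that the root has exactly one child.\<close>

definition size_ratio :: real where
  "size_ratio = pmf (P 1) (star 1) / p 1"

lemma size_ratio_tendsto: "(\<lambda>N. size_prob N / size_prob (Suc N)) \<longlonglongrightarrow> size_ratio"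
proof -
  have p1: "p 1 > 0" using p_pos[of 1] D_ge_2 by simp
  have "(\<lambda>N. size_trunc_prob 1 (star 1) (Suc N) / size_prob (Suc N) / p 1) \<longlonglongrightarrow> size_ratio"
    unfolding size_ratio_def
    by (intro tendsto_divide LIMSEQ_Suc[OF P_limit] tendsto_const) (use p1 in auto)
  then show ?thesis using p1 by (simp add: size_trunc_prob_star_1 del: One_nat_def)
qed

text \<open>With a ratio below 1 the reciprocals \<open>1 / size_prob N\<close> would be summable by
  the ratio test and tend to 0, yet they are at least 1.\<close>

lemma size_ratio_ge_1: "size_ratio \<ge> 1"
proof (rule ccontr)
  assume "\<not> size_ratio \<ge> 1"
  then obtain q where q: "size_ratio < q" "q < 1" using dense[of size_ratio 1] by auto
  have "\<forall>\<^sub>F N in sequentially. size_prob N / size_prob (Suc N) < q"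
    by (rule order_tendstoD(2)[OF size_ratio_tendsto q(1)])
  then obtain N0 where N0: "\<And>N. N \<ge> N0 \<Longrightarrow> size_prob N / size_prob (Suc N) < q"
    by (auto simp: eventually_sequentially)
  have "summable (\<lambda>N. 1 / size_prob N)"
  proof (rule summable_ratio_test[OF q(2), of "max 1 N0"])
    fix N assume "N \<ge> max 1 N0"
    then have "size_prob N > 0" "size_prob (Suc N) > 0" "size_prob N / size_prob (Suc N) < q"
      using size_prob_pos N0 by auto
    then show "norm (1 / size_prob (Suc N)) \<le> q * norm (1 / size_prob N)"
      by (simp add: field_simps)
  qed
  then have "(\<lambda>N. 1 / size_prob N) \<longlonglongrightarrow> 0" by (rule summable_LIMSEQ_zero)
  moreover have "\<forall>\<^sub>F N in sequentially. 1 \<le> 1 / size_prob N"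
    using eventually_ge_at_top[of 1]
  proof eventually_elim
    case (elim N)
    then show ?case using size_prob_pos[of N] size_prob_le_1[of N] by simp
  qed
  ultimately have "(1::real) \<le> 0" by (intro tendsto_lowerbound) auto
  then show False by simp
qed

lemma size_ratio_shift: "(\<lambda>N. size_prob (N - j) / size_prob N) \<longlonglongrightarrow> size_ratio ^ j"
\<comment> \<open>After shifting the index by \<open>j\<close> the natural subtraction is exact and
  the quotient is a product of \<open>j\<close> consecutive ratios.\<close>
proof (rule LIMSEQ_offset[of _ j])
  have "(\<lambda>N. size_prob N / size_prob (N + j)) \<longlonglongrightarrow> size_ratio ^ j"
  proof (induction j)
    case 0
    have "\<forall>\<^sub>F N in sequentially. size_prob N / size_prob N = 1"
      using eventually_ge_at_top[of 1] by eventually_elim (use size_prob_pos in force)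
    then show ?case by (simp add: tendsto_eventually)
  next
    case (Suc j)
    have "(\<lambda>N. size_prob N / size_prob (N + j) * (size_prob (N + j) / size_prob (Suc (N + j))))
        \<longlonglongrightarrow> size_ratio ^ j * size_ratio"
      by (intro tendsto_mult Suc LIMSEQ_ignore_initial_segment[OF size_ratio_tendsto])
    moreover have "\<forall>\<^sub>F N in sequentially.
        size_prob N / size_prob (N + j) * (size_prob (N + j) / size_prob (Suc (N + j))) =
        size_prob N / size_prob (N + Suc j)"
      using eventually_ge_at_top[of 1]
    proof eventually_elim
      case (elim N)
      then show ?case using size_prob_pos[of "N + j"] by simp
    qed
    ultimately have "(\<lambda>N. size_prob N / size_prob (N + Suc j)) \<longlonglongrightarrow> size_ratio ^ j * size_ratio"
      by (rule Lim_transform_eventually)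
    then show ?case by (simp add: mult.commute)
  qed
  then show "(\<lambda>N. size_prob (N + j - j) / size_prob (N + j)) \<longlonglongrightarrow> size_ratio ^ j" by simp
qed

text \<open>Divide the lower bound by \<open>size_prob N\<close> and let \<open>N\<close> tend to
  infinity, then \<open>h\<close>. Each of the small subtrees contributes an extinction probability,
  which tends to 1, so every vertex of generation \<open>n\<close> contributes 1.\<close>

lemma P_ge:
  assumes n: "n \<ge> 1" and S: "S \<in> trees_upto D n"
  shows "trunc_prob p n S * real (generation_size n S) \<le> pmf (P n) S"
proof -
  define L where "L = level n S"
  have tr: "S \<in> trees D" using S by (simp add: trees_upto_def)
  have fin: "finite L" using finite_level[OF tr] by (simp add: L_def)
  have bound: "trunc_prob p n S * (\<Sum>v\<in>L. \<Prod>u\<in>L - {v}. (\<phi> ^^ h) 0) \<le> pmf (P n) S" for h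
  proof -
    let ?G = "\<lambda>v. PiE (L - {v}) (\<lambda>_. trees_below D h)"
    let ?w = "\<lambda>v g. \<Prod>u\<in>L - {v}. tree_prob p (g u)"
    let ?c = "\<lambda>v g. card (below n S) + (\<Sum>u\<in>L - {v}. card (g u))"
    have "(\<lambda>N. trunc_prob p n S * (\<Sum>v\<in>L. \<Sum>g\<in>?G v. ?w v g * (size_prob (N - ?c v g) / size_prob N)))
        \<longlonglongrightarrow> trunc_prob p n S * (\<Sum>v\<in>L. \<Sum>g\<in>?G v. ?w v g * size_ratio ^ ?c v g)"
      by (intro tendsto_mult tendsto_sum tendsto_const size_ratio_shift)
    moreover have "\<forall>\<^sub>F N in sequentially.
        trunc_prob p n S * (\<Sum>v\<in>L. \<Sum>g\<in>?G v. ?w v g * (size_prob (N - ?c v g) / size_prob N))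
        \<le> size_trunc_prob n S N / size_prob N"
      using size_trunc_prob_ge[OF S, of h, folded L_def] eventually_ge_at_top[of 1]
    proof eventually_elim
      case (elim N)
      then show ?case
        using divide_right_mono[OF elim(1) less_imp_le[OF size_prob_pos[OF elim(2)]]]
        by (simp flip: sum_divide_distrib)
    qed
    ultimately have *: "trunc_prob p n S * (\<Sum>v\<in>L. \<Sum>g\<in>?G v. ?w v g * size_ratio ^ ?c v g) \<le> pmf (P n) S"
      by (rule tendsto_le[OF sequentially_bot P_limit[OF n]])
    have "(\<Sum>v\<in>L. \<Prod>u\<in>L - {v}. (\<phi> ^^ h) 0) = (\<Sum>v\<in>L. \<Sum>g\<in>?G v. ?w v g)"
      using fin by (intro sum.cong refl, subst prod_sum_PiE[symmetric])
        (simp_all add: finite_trees_below extinction_prob)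
    \<comment> \<open>Powers of \<open>size_ratio\<close> may be inserted at no loss because the
      ratio is at least 1.\<close>
    also have "\<dots> \<le> (\<Sum>v\<in>L. \<Sum>g\<in>?G v. ?w v g * size_ratio ^ ?c v g)"
    proof (intro sum_mono)
      fix v g assume "g \<in> ?G v"
      then have "0 \<le> ?w v g"
        by (intro prod_nonneg ballI less_imp_le[OF tree_prob_pos]) (auto simp: PiE_iff trees_below_def)
      then show "?w v g \<le> ?w v g * size_ratio ^ ?c v g"
        using one_le_power[OF size_ratio_ge_1] by (simp add: mult_le_cancel_left1)
    qed
    finally show ?thesis
      by (rule order_trans[OF mult_left_mono[OF _ less_imp_le[OF trunc_prob_pos[OF tr]]] *])
  qed
  have "(\<lambda>h. trunc_prob p n S * (\<Sum>v\<in>L. \<Prod>u\<in>L - {v}. (\<phi> ^^ h) 0))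
      \<longlonglongrightarrow> trunc_prob p n S * (\<Sum>v\<in>L. \<Prod>u\<in>L - {v}. 1)"
    by (intro tendsto_intros extinction_tendsto)
  then have "trunc_prob p n S * (\<Sum>v\<in>L. \<Prod>u\<in>L - {v}. 1) \<le> pmf (P n) S"
    by (rule LIMSEQ_le_const2) (use bound in auto)
  then show ?thesis by (simp add: generation_size_eq_card_level L_def)
qed

text \<open>The derivative of the generating function of generation \<open>n\<close> computed twice:
  term by term, and by the chain rule for iterates.\<close>

lemma sum_level_gf_deriv:
  fixes s :: "'a::real_normed_field"
  shows "(\<Sum>S\<in>trees_upto D n. of_real (trunc_prob p n S) *
      (of_nat (generation_size n S) * s ^ (generation_size n S - 1))) =
   (\<Prod>j<n. \<phi>' ((\<phi> ^^ j) s))"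
proof (rule DERIV_unique)
  have "level_gf D p n = \<phi> ^^ n" by (rule ext) (rule level_gf_eq_funpow)
  then show "(level_gf D p n has_field_derivative (\<Prod>j<n. \<phi>' ((\<phi> ^^ j) s))) (at s)"
    using has_field_derivative_funpow_offspring_gf by metis
  show "(level_gf D p n has_field_derivative
      (\<Sum>S\<in>trees_upto D n. of_real (trunc_prob p n S) *
        (of_nat (generation_size n S) * s ^ (generation_size n S - 1)))) (at s)"
    unfolding level_gf_def[abs_def] by (auto intro!: derivative_eq_intros sum.cong)
qed

text \<open>At \<open>s = 1\<close> every chain-rule factor is 1, so the size-biased weights have
  total mass 1, as does \<open>P n\<close>. A termwise inequality between finite sums with equal
  totals is an equality.\<close>

lemma P_eq:
  assumes n: "n \<ge> 1" and S: "S \<in> trees_upto D n"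
  shows "pmf (P n) S = trunc_prob p n S * real (generation_size n S)"
proof -
  have "(\<Sum>S\<in>trees_upto D n. trunc_prob p n S * real (generation_size n S)) = 1"
    using sum_level_gf_deriv[of n "1::real"] by (simp add: funpow_gf_1 gf_deriv_1)
  also have "\<dots> = (\<Sum>S\<in>trees_upto D n. pmf (P n) S)"
    using sum_pmf_eq_1[OF finite_trees_upto P_support[OF n]] by simp
  finally show ?thesis
    by (rule sum_mono_inv[OF _ P_ge[OF n] S finite_trees_upto, symmetric])
qed

lemma generation_size_char:
  fixes s :: complex
  assumes n: "n \<ge> 1"
  shows "measure_pmf.expectation (P n) (\<lambda>S. s ^ generation_size n S) =
    s * (\<Prod>j<n. \<phi>' ((\<phi> ^^ j) s))"
proof -
  have "measure_pmf.expectation (P n) (\<lambda>S. s ^ generation_size n S) =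
      (\<Sum>S\<in>trees_upto D n. pmf (P n) S *\<^sub>R s ^ generation_size n S)"
    using P_support[OF n] by (intro integral_measure_pmf finite_trees_upto) auto
  also have "\<dots> = (\<Sum>S\<in>trees_upto D n. s * (of_real (trunc_prob p n S) *
      (of_nat (generation_size n S) * s ^ (generation_size n S - 1))))"
  proof (rule sum.cong[OF refl])
    fix S assume "S \<in> trees_upto D n"
    then show "pmf (P n) S *\<^sub>R s ^ generation_size n S = s * (of_real (trunc_prob p n S) *
        (of_nat (generation_size n S) * s ^ (generation_size n S - 1)))"
      \<comment> \<open>An empty generation is separated because of the truncated exponent; there
        \<open>P_eq\<close> gives weight 0.\<close>
      by (cases "generation_size n S") (simp_all add: P_eq[OF n] scaleR_conv_of_real)
  qed
  finally show ?thesis unfolding sum_distrib_left[symmetric] sum_level_gf_deriv .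
qed

end

section \<open>The Gibbs measure\<close>

text \<open>Every vertex except the root is a child of exactly one vertex.\<close>

lemma sum_deg:
  assumes T: "T \<in> trees D" and fin: "finite T"
  shows "(\<Sum>v\<in>T. deg T v) = card T - 1"
proof -
  have "T - {[]} = (\<Union>v\<in>T. (\<lambda>i. v @ [i]) ` children T v)"
  proof (intro set_eqI iffI)
    fix w assume w: "w \<in> T - {[]}"
    then obtain v i where vi: "w = v @ [i]" by (cases w rule: rev_cases) auto
    then have "v \<in> T" using w tree_prefix_closed[OF T, of v "[i]"] by simp
    then show "w \<in> (\<Union>v\<in>T. (\<lambda>i. v @ [i]) ` children T v)"
      using w vi by (auto simp: children_def)
  qed (auto simp: children_def)
  then have "card (T - {[]}) = card (\<Union>v\<in>T. (\<lambda>i. v @ [i]) ` children T v)"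
    by simp
  also have "\<dots> = (\<Sum>v\<in>T. card ((\<lambda>i. v @ [i]) ` children T v))"
    using fin T by (intro card_UN_disjoint) (auto simp: trees_def plane_tree_def)
  also have "\<dots> = (\<Sum>v\<in>T. deg T v)"
    by (simp add: deg_def card_image inj_on_def)
  finally show ?thesis using fin root_in_tree[OF T] by simp
qed

lemma tv_dist_ge: "\<bar>measure_pmf.prob p A - measure_pmf.prob q A\<bar> \<le> tv_dist p q"
  unfolding tv_dist_def
proof (rule cSUP_upper)
  have "\<bar>measure_pmf.prob p A - measure_pmf.prob q A\<bar> \<le> 1" for A
    using measure_pmf.prob_le_1[of p A] measure_pmf.prob_le_1[of q A]
      measure_nonneg[of p A] measure_nonneg[of q A] by linarith
  then show "bdd_above (range (\<lambda>A. \<bar>measure_pmf.prob p A - measure_pmf.prob q A\<bar>))"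
    by (rule bdd_aboveI2)
qed simp

lemma trunc_limit_pointwise:
  assumes "is_trunc_limit D E \<beta> n Q"
  shows "(\<lambda>N. pmf (map_pmf (trunc n) (gibbs D E \<beta> N)) S) \<longlonglongrightarrow> pmf Q S"
proof -
  have "(\<lambda>N. tv_dist (map_pmf (trunc n) (gibbs D E \<beta> N)) Q) \<longlonglongrightarrow> 0"
    using assms by (simp add: is_trunc_limit_def)
  then have "(\<lambda>N. pmf (map_pmf (trunc n) (gibbs D E \<beta> N)) S - pmf Q S) \<longlonglongrightarrow> 0"
    by (rule Lim_null_comparison[rotated])
       (use tv_dist_ge[of _ "{S}"] in \<open>auto simp: measure_pmf_single\<close>)
  then show ?thesis by (simp add: LIM_zero_iff)
qed

context critical_offspring
begin

context
  fixes C r \<beta> :: real and E :: "nat \<Rightarrow> real"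
  assumes C: "C > 0" and r: "r > 0"
    and gibbs_weight: "\<And>i. i \<le> D \<Longrightarrow> p i = C * r ^ i * exp (- \<beta> * E i)"
begin

text \<open>The tilt contributes \<open>r\<close> once per edge, and every tree of size
  \<open>N\<close> has \<open>N - 1\<close> edges. The tilt and the normalisation are thus constant
  on trees of equal size and cancel in the Gibbs measure.\<close>

lemma tree_prob_gibbs:
  assumes T: "T \<in> trees_of_size D N"
  shows "tree_prob p T = C ^ N * r ^ (N - 1) * exp (- \<beta> * energy E T)"
proof -
  have T': "T \<in> trees D" "finite T" "card T = N" using T by (auto simp: trees_of_size_def)
  have "tree_prob p T = (\<Prod>v\<in>T. C * r ^ deg T v * exp (- \<beta> * E (deg T v)))"
    unfolding tree_prob_def using T'(1) by (intro prod.cong refl gibbs_weight) (auto simp: trees_def)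
  also have "\<dots> = C ^ N * r ^ (\<Sum>v\<in>T. deg T v) * exp (- \<beta> * energy E T)"
    using T' by (simp add: prod.distrib power_sum energy_def sum_distrib_left flip: sum_negf exp_sum)
  finally show ?thesis by (simp add: sum_deg[OF T'(1,2)] T'(3))
qed

lemma pmf_gibbs_tree_prob:
  assumes N: "N \<ge> 1"
  shows "pmf (gibbs D E \<beta> N) T =
    (if T \<in> trees_of_size D N then tree_prob p T / size_prob N else 0)"
proof -
  have "size_prob N = C ^ N * r ^ (N - 1) * partition_function D E \<beta> N"
    unfolding size_prob_def partition_function_def sum_distrib_left
    by (intro sum.cong refl tree_prob_gibbs)
  then show ?thesis using C r N D_ge_2 by (simp add: pmf_gibbs tree_prob_gibbs)
qed

lemma pmf_trunc_gibbs:
  assumes N: "N \<ge> 1"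
  shows "pmf (map_pmf (trunc n) (gibbs D E \<beta> N)) S = size_trunc_prob n S N / size_prob N"
proof -
  let ?A = "{T \<in> trees_of_size D N. trunc n T = S}"
  have supp: "set_pmf (gibbs D E \<beta> N) \<subseteq> trees_of_size D N"
    by (auto simp: set_pmf_iff pmf_gibbs_tree_prob[OF N] split: if_splits)
  have "pmf (map_pmf (trunc n) (gibbs D E \<beta> N)) S = measure_pmf.prob (gibbs D E \<beta> N) (trunc n -` {S})"
    by (simp add: pmf_map)
  also have "\<dots> = measure_pmf.prob (gibbs D E \<beta> N) ?A"
    using supp by (intro measure_prob_cong_0) (auto simp: set_pmf_iff)
  also have "\<dots> = (\<Sum>T\<in>?A. pmf (gibbs D E \<beta> N) T)"
    by (simp add: measure_measure_pmf_finite finite_trees_of_size)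
  also have "\<dots> = size_trunc_prob n S N / size_prob N"
    by (simp add: size_trunc_prob_def pmf_gibbs_tree_prob[OF N] sum_divide_distrib)
  finally show ?thesis .
qed

lemma size_conditioned_limit_gibbs:
  assumes P: "\<And>n. n \<ge> 1 \<Longrightarrow> is_trunc_limit D E \<beta> n (P n)"
  shows "size_conditioned_limit D p P"
proof
  fix n :: nat assume n: "n \<ge> 1"
  show "set_pmf (P n) \<subseteq> trees_upto D n"
    using P[OF n] trees_of_height_subset by (auto simp: is_trunc_limit_def)
  show "(\<lambda>N. size_trunc_prob n S N / size_prob N) \<longlonglongrightarrow> pmf (P n) S" for S
    by (rule Lim_transform_eventually[OF trunc_limit_pointwise[OF P[OF n]]])
       (rule eventually_mono[OF eventually_ge_at_top[of 1] pmf_trunc_gibbs])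
qed

end

end

section \<open>The minimizer as an exponential tilt\<close>

lemma mult_ln_diff_ge:
  fixes q g :: real
  assumes q: "q \<ge> 0" and g: "g > 0"
  shows "q - g \<le> q * (ln q - ln g)"
    and "q * (ln q - ln g) = q - g \<Longrightarrow> q = g"
proof -
  consider "q = 0" | "q > 0" using q by linarith
  then have "q - g \<le> q * (ln q - ln g) \<and> (q * (ln q - ln g) = q - g \<longrightarrow> q = g)"
  proof cases
    case 2
    \<comment> \<open>This is \<open>ln x \<le> x - 1\<close> at \<open>x = g / q\<close>, where
      equality holds only for \<open>x = 1\<close>.\<close>
    have "q * ln (g / q) \<le> q * (g / q - 1)"
      using 2 g by (intro mult_left_mono ln_le_minus_one) auto
    moreover have "q = g" if "q * (ln q - ln g) = q - g"
    proof -
      have "q * ln (g / q) = q * (g / q - 1)"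
        using 2 g that by (simp add: ln_div algebra_simps)
      then have "ln (g / q) = g / q - 1" using 2 by simp
      then have "g / q = 1" using 2 g by (intro ln_eq_minus_one) auto
      then show ?thesis using 2 by simp
    qed
    ultimately show ?thesis using 2 g by (simp add: ln_div algebra_simps)
  qed (use g in auto)
  then show "q - g \<le> q * (ln q - ln g)" "q * (ln q - ln g) = q - g \<Longrightarrow> q = g" by auto
qed

text \<open>The sum vanishes exactly when the law proportional to \<open>r ^ i * w i\<close> has
  mean one. A root is found by the intermediate value theorem, starting from the negative value at
  0.\<close>

lemma ex_mean_one_tilt:
  fixes w :: "nat \<Rightarrow> real"
  assumes D: "D \<ge> 2" and w: "\<And>i. w i > 0"
  obtains r where "r > 0" "(\<Sum>i\<le>D. (real i - 1) * (r ^ i * w i)) = 0"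
proof -
  define h where "h x = (\<Sum>i\<le>D. (real i - 1) * (x ^ i * w i))" for x
  \<comment> \<open>Chosen so that the term \<open>i = 2\<close> alone cancels the term
    \<open>- w 0\<close>; all remaining terms are nonnegative.\<close>
  define b where "b = sqrt (w 0 / w 2)"
  have split: "h x = - w 0 + (\<Sum>i=1..D. (real i - 1) * (x ^ i * w i))" for x
    unfolding h_def by (simp add: sum.atLeast1_atMost_eq sum.atMost_shift)
  have h0: "h 0 = - w 0" by (simp add: split power_0_left)
  have hb: "h b \<ge> 0"
  proof -
    have "w 0 = (real 2 - 1) * (b ^ 2 * w 2)"
      using w[of 0] w[of 2] by (simp add: b_def)
    also have "\<dots> \<le> (\<Sum>i=1..D. (real i - 1) * (b ^ i * w i))"
    proof (rule member_le_sum)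
      show "0 \<le> (real i - 1) * (b ^ i * w i)" if "i \<in> {1..D} - {2}" for i
        using that w[of i] w[of 0] w[of 2] by (auto simp: b_def)
    qed (use D in auto)
    finally show ?thesis by (simp add: split)
  qed
  have "\<exists>x\<ge>0. x \<le> b \<and> h x = 0"
    using h0 hb w[of 0] w[of 2] unfolding h_def[abs_def]
    by (intro IVT') (auto simp: b_def h_def intro!: continuous_intros)
  then obtain x where x: "x \<ge> 0" "h x = 0" by auto
  moreover have "x \<noteq> 0" using x h0 w[of 0] by auto
  ultimately show ?thesis using that[of x] by (simp add: h_def)
qed

text \<open>On the simplex the free energy is the relative entropy with respect to the mean-one tilt
  \<open>g\<close>, up to a constant, because the two linear constraints fix all other terms. As
  \<open>g\<close> is admissible with relative entropy 0, the minimizer coincides with it.\<close>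

lemma free_energy_minimizer:
  assumes D: "D \<ge> 2" and min: "is_arg_min (free_energy D E \<beta>) (\<lambda>q. q \<in> simplex_mean_one D) p"
  obtains C r where "C > 0" "r > 0" "\<And>i. i \<le> D \<Longrightarrow> p i = C * r ^ i * exp (- \<beta> * E i)"
proof -
  obtain r where r: "r > 0" "(\<Sum>i\<le>D. (real i - 1) * (r ^ i * exp (- \<beta> * E i))) = 0"
    using ex_mean_one_tilt[OF D, of "\<lambda>i. exp (- \<beta> * E i)"] by auto
  define Z where "Z = (\<Sum>i\<le>D. r ^ i * exp (- \<beta> * E i))"
  have Z: "Z > 0" unfolding Z_def using r(1) by (intro sum_pos) auto
  define g where "g i = 1 / Z * r ^ i * exp (- \<beta> * E i)" for i
  have g_pos: "g i > 0" for i using Z r(1) by (simp add: g_def)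
  have g_sum: "(\<Sum>i\<le>D. g i) = 1"
    using Z by (simp add: g_def Z_def flip: sum_divide_distrib)
  have "(\<Sum>i\<le>D. real i * g i) - (\<Sum>i\<le>D. g i) = (\<Sum>i\<le>D. (real i - 1) * (r ^ i * exp (- \<beta> * E i))) / Z"
    unfolding sum_subtractf[symmetric] sum_divide_distrib
    by (intro sum.cong refl) (simp add: g_def algebra_simps diff_divide_distrib)
  then have g_mean: "(\<Sum>i\<le>D. real i * g i) = 1" using r(2) g_sum by simp
  have g: "g \<in> simplex_mean_one D"
    using g_pos g_sum g_mean member_le_sum[of _ "{..D}" g]
    by (auto simp: simplex_mean_one_def less_imp_le)
  \<comment> \<open>Subtracting \<open>q i - g i\<close>, which sums to 0, makes each summand
    nonnegative, so a zero sum can be analysed term by term.\<close>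
  have free_energy: "free_energy D E \<beta> q = (\<Sum>i\<le>D. q i * (ln (q i) - ln (g i)) - (q i - g i)) + (ln r - ln Z)"
    if q: "q \<in> simplex_mean_one D" for q
  proof -
    have *: "(\<Sum>i\<le>D. q i) = 1" "(\<Sum>i\<le>D. real i * q i) = 1"
      using q by (auto simp: simplex_mean_one_def)
    have ln_g: "\<beta> * E i = real i * ln r - ln Z - ln (g i)" for i
      using Z r(1) by (simp add: g_def ln_mult ln_div ln_realpow)
    have "free_energy D E \<beta> q = (\<Sum>i\<le>D. q i * (ln (q i) + \<beta> * E i))"
      by (simp add: free_energy_def sum_distrib_left sum.distrib algebra_simps)
    also have "\<dots> = (\<Sum>i\<le>D. (q i * (ln (q i) - ln (g i)) - (q i - g i)) + (q i - g i)
        + real i * q i * ln r - q i * ln Z)"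
      by (intro sum.cong refl) (simp add: ln_g algebra_simps)
    also have "\<dots> = (\<Sum>i\<le>D. q i * (ln (q i) - ln (g i)) - (q i - g i)) + (1 - 1) + 1 * ln r - 1 * ln Z"
      by (simp only: sum.distrib sum_subtractf sum_distrib_right[symmetric] * g_sum)
    finally show ?thesis by simp
  qed
  have p: "p \<in> simplex_mean_one D" "free_energy D E \<beta> p \<le> free_energy D E \<beta> g"
    using min g by (auto simp: is_arg_min_def not_less)
  have nonneg: "0 \<le> p i * (ln (p i) - ln (g i)) - (p i - g i)" if "i \<le> D" for i
    using mult_ln_diff_ge(1)[of "p i" "g i"] p(1) g_pos[of i] that by (simp add: simplex_mean_one_def)
  have "(\<Sum>i\<le>D. p i * (ln (p i) - ln (g i)) - (p i - g i)) \<le> 0"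
    using p(2) unfolding free_energy[OF p(1)] free_energy[OF g] by simp
  then have "(\<Sum>i\<le>D. p i * (ln (p i) - ln (g i)) - (p i - g i)) = 0"
    using nonneg by (intro antisym sum_nonneg) auto
  then have "p i = g i" if "i \<le> D" for i
    using that nonneg p(1) mult_ln_diff_ge(2)[of "p i" "g i"] g_pos[of i]
    by (subst (asm) sum_nonneg_eq_0_iff) (auto simp: simplex_mean_one_def)
  then show ?thesis using that[of "1 / Z" r] Z r(1) by (simp add: g_def)
qed

section \<open>The limit law\<close>

text \<open>The Erlang index is one less than the shape: index 1 and rate 1 give the Gamma law of
  shape 2.\<close>

lemma gamma2_density_eq_erlang:
  "(\<lambda>t. ennreal (if t \<ge> 0 then t * exp (- t) else 0)) = (\<lambda>t. ennreal (erlang_density 1 1 t))"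
  by (auto simp: erlang_density_def fun_eq_iff)

lemma real_distribution_erlang: "real_distribution (density lborel (erlang_density k 1))"
  unfolding real_distribution_def real_distribution_axioms_def
  by (simp add: prob_space_erlang_density)

text \<open>With \<open>a = 1 - \<i> \<theta>\<close> the integrand is \<open>x exp (- a x)\<close>.
  Its antiderivative \<open>F\<close>, found by parts, is \<open>- 1 / a ^ 2\<close> at 0 and
  vanishes at infinity because \<open>a\<close> has real part 1.\<close>

lemma char_erlang_1_1:
  "char (density lborel (erlang_density 1 1)) \<theta> = 1 / (1 - \<i> * of_real \<theta>) ^ 2"
proof -
  interpret real_distribution "density lborel (erlang_density 1 1)"
    by (rule real_distribution_erlang)
  define a where "a = 1 - \<i> * of_real \<theta>"
  have a: "a \<noteq> 0" by (auto simp: a_def complex_eq_iff)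
  define f where "f x = of_real x * exp (- a * of_real x)" for x :: real
  define F where "F x = - (of_real x / a + 1 / a ^ 2) * exp (- a * of_real x)" for x :: real
  have dens: "erlang_density 1 1 x *\<^sub>R iexp (\<theta> * x) = indicator {0<..} x *\<^sub>R f x" for x
    by (auto simp: erlang_density_def f_def a_def indicator_def scaleR_conv_of_real exp_of_real[symmetric]
        exp_add[symmetric] algebra_simps simp del: exp_of_real)
  have "integrable (density lborel (erlang_density 1 1)) (\<lambda>x. iexp (\<theta> * x))"
    by (rule integrable_const_bound[of _ 1]) auto
  then have "integrable lborel (\<lambda>x. erlang_density 1 1 x *\<^sub>R iexp (\<theta> * x))"
    by (subst (asm) integrable_density) simp_all
  then have int: "set_integrable lborel {0<..} f"
    unfolding dens set_integrable_def .
  have "char (density lborel (erlang_density 1 1)) \<theta> =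
      (CLINT x|lborel. erlang_density 1 1 x *\<^sub>R iexp (\<theta> * x))"
    unfolding char_def by (rule integral_density) simp_all
  also have "\<dots> = (LBINT x:{0<..}. f x)"
    unfolding dens set_lebesgue_integral_def ..
  also have "\<dots> = (LBINT x=0..\<infinity>. f x)" by (simp add: interval_lebesgue_integral_0_infty)
  also have "\<dots> = 0 - (- 1 / a ^ 2)"
  proof (rule interval_integral_FTC_integrable)
    show "(F has_vector_derivative f x) (at x)" for x
    proof -
      have "((\<lambda>z. - (z / a + 1 / a ^ 2) * exp (- a * z)) has_field_derivative
          of_real x * exp (- a * of_real x)) (at (of_real x))"
        using a by (auto intro!: derivative_eq_intros simp: field_simps power2_eq_square)
      then show ?thesis
        unfolding F_def[abs_def] f_def by (rule has_vector_derivative_real_field)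
    qed
    show "isCont f x" for x unfolding f_def[abs_def] by (intro continuous_intros)
    show "set_integrable lborel (einterval 0 \<infinity>) f"
      using int by (simp add: zero_ereal_def)
    have "(F \<longlongrightarrow> F 0) (at_right 0)"
      unfolding F_def[abs_def] using a by (intro tendsto_intros) auto
    then show "((F \<circ> real_of_ereal) \<longlongrightarrow> - 1 / a ^ 2) (at_right 0)"
      by (simp add: ereal_tendsto_simps zero_ereal_def F_def)
    have "(F \<longlongrightarrow> 0) at_top"
    proof (rule Lim_null_comparison)
      show "\<forall>\<^sub>F x in at_top. norm (F x) \<le> x ^ 1 / exp x * (1 / norm a) + x ^ 0 / exp x * (1 / norm a ^ 2)"
        using eventually_ge_at_top[of 0]
      proof eventually_elim
        case (elim x)
        have "norm (exp (- a * of_real x)) = exp (- x)"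
          by (simp add: norm_exp_eq_Re a_def)
        then have "norm (F x) = norm (of_real x / a + 1 / a ^ 2) * exp (- x)"
          by (simp only: F_def norm_mult norm_minus_cancel)
        also have "\<dots> \<le> (x / norm a + 1 / norm a ^ 2) * exp (- x)"
          using elim norm_triangle_ineq[of "of_real x / a" "1 / a ^ 2"]
          by (intro mult_right_mono) (auto simp: norm_divide norm_power)
        finally show ?case by (simp add: exp_minus divide_inverse algebra_simps)
      qed
      have "((\<lambda>x. x ^ 1 / exp x * (1 / norm a) + x ^ 0 / exp x * (1 / norm a ^ 2)) \<longlongrightarrow>
          0 * (1 / norm a) + 0 * (1 / norm a ^ 2)) at_top"
        by (intro tendsto_intros tendsto_power_div_exp_0)
      then show "((\<lambda>x. x ^ 1 / exp x * (1 / norm a) + x ^ 0 / exp x * (1 / norm a ^ 2)) \<longlongrightarrow> 0) at_top"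
        by simp
    qed
    then show "((F \<circ> real_of_ereal) \<longlongrightarrow> 0) (at_left \<infinity>)"
      by (simp add: ereal_tendsto_simps)
  qed simp
  finally show ?thesis by (simp add: a_def)
qed

text \<open>The derivative of the exponential at 0, evaluated along \<open>c / n\<close>; the case
  \<open>c = 0\<close> is separate because the difference quotient divides by it.\<close>

lemma exp_scaled_tendsto: "(\<lambda>n. of_nat n * (1 - exp (c / of_nat n))) \<longlonglongrightarrow> - c" for c :: complex
proof (cases "c = 0")
  case False
  have "((\<lambda>h::complex. (exp h - 1) / h) \<longlongrightarrow> 1) (at 0)"
    using DERIV_exp[of "0::complex"] unfolding DERIV_def by simp
  moreover have "filterlim (\<lambda>n. c / of_nat n) (at 0) sequentially"
    unfolding filterlim_at
  proof
    show "\<forall>\<^sub>F n in sequentially. c / of_nat n \<in> UNIV \<and> c / of_nat n \<noteq> 0"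
      using eventually_gt_at_top[of 0] by eventually_elim (use False in auto)
    show "(\<lambda>n. c / of_nat n) \<longlonglongrightarrow> 0" by (rule lim_const_over_n)
  qed
  ultimately have "(\<lambda>n. (exp (c / of_nat n) - 1) / (c / of_nat n)) \<longlonglongrightarrow> 1"
    by (rule filterlim_compose)
  then have "(\<lambda>n. - c * ((exp (c / of_nat n) - 1) / (c / of_nat n))) \<longlonglongrightarrow> - c * 1"
    by (intro tendsto_mult tendsto_const)
  moreover have "- c * ((exp (c / of_nat n) - 1) / (c / of_nat n)) =
      of_nat n * (1 - exp (c / of_nat n))" for n
    using False by (simp add: algebra_simps diff_divide_distrib)
  ultimately show ?thesis by simp
qed simp

section \<open>Characteristic functions of the rescaled generation sizes\<close>

context size_conditioned_limit
begin

context
  fixes M :: "vertex set measure"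
  assumes M: "is_projective_limit D P M"
begin

lemma prob_space_M: "prob_space M"
  and sets_M: "sets M = sets (tree_space D)"
  and distr_M: "n \<ge> 1 \<Longrightarrow> distr M (count_space UNIV) (trunc n) = measure_pmf (P n)"
  using M by (auto simp: is_projective_limit_def)

lemma measurable_M: "M \<rightarrow>\<^sub>M N = tree_space D \<rightarrow>\<^sub>M N"
  by (rule measurable_cong_sets) (simp_all add: sets_M)

lemma measurable_scaled_size: "(\<lambda>T. real (generation_size n T) / c * d) \<in> borel_measurable M"
  unfolding measurable_M
  by (rule measurable_compose[OF measurable_generation_size, of "\<lambda>k. real k / c * d"]) simp

text \<open>At \<open>n = 0\<close> division by zero yields the point mass at 0, so every term of
  the sequence is a probability law, as Levy's theorem requires.\<close>

definition scaled_law :: "nat \<Rightarrow> real measure" where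
  "scaled_law n = distr M borel (\<lambda>T. real (generation_size n T) / real n * (2 / \<mu>))"

lemma real_distribution_scaled_law: "real_distribution (scaled_law n)"
proof -
  interpret prob_space M by (rule prob_space_M)
  show ?thesis unfolding scaled_law_def
    by (intro real_distribution_distr measurable_scaled_size)
qed

text \<open>The rescaling is absorbed into the point \<open>s\<close> on the unit circle, and
  generation \<open>n\<close> is visible in \<open>trunc n T\<close>, so the integral reduces to one
  over \<open>P n\<close>.\<close>

lemma char_scaled_law:
  assumes n: "n \<ge> 1"
  shows "char (scaled_law n) \<theta> =
    (let s = exp (\<i> * of_real (2 * \<theta> / \<mu>) / of_nat n) in s * (\<Prod>j<n. \<phi>' ((\<phi> ^^ j) s)))"
proof -
  define s where "s = exp (\<i> * of_real (2 * \<theta> / \<mu>) / of_nat n)"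
  have gen: "generation_size n (trunc n T) = generation_size n T" for T
    by (auto simp: generation_size_def trunc_def intro!: arg_cong[of _ _ card])
  have pow: "iexp (\<theta> * (real k / real n * (2 / \<mu>))) = s ^ k" for k
    unfolding s_def exp_of_nat_mult[symmetric] by (rule arg_cong[of _ _ exp]) (simp add: field_simps)
  have "char (scaled_law n) \<theta> =
      (CLINT T|M. iexp (\<theta> * (real (generation_size n T) / real n * (2 / \<mu>))))"
    unfolding char_def scaled_law_def by (rule integral_distr[OF measurable_scaled_size]) simp
  also have "\<dots> = (CLINT T|M. s ^ generation_size n (trunc n T))"
    by (simp only: pow gen)
  also have "\<dots> = measure_pmf.expectation (P n) (\<lambda>S. s ^ generation_size n S)"
    unfolding distr_M[OF n, symmetric]
    by (subst integral_distr) (auto simp: measurable_M)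
  finally show ?thesis by (simp add: generation_size_char[OF n] s_def Let_def)
qed

lemma char_scaled_law_tendsto: "(\<lambda>n. char (scaled_law n) \<theta>) \<longlonglongrightarrow> 1 / (1 - \<i> * of_real \<theta>) ^ 2"
proof (cases "\<theta> = 0")
  \<comment> \<open>Here \<open>s n\<close> would be the fixed point 1 itself, where the reciprocal
    coordinate is undefined; characteristic functions equal 1 at 0.\<close>
  case True
  interpret real_distribution "scaled_law n" for n by (rule real_distribution_scaled_law)
  show ?thesis using True char_zero by simp
next
  case False
  define c where "c = \<i> * of_real (2 * \<theta> / \<mu>)"
  define s where "s n = exp (c / of_nat n)" for n
  have c: "c \<noteq> 0" using False variance_pos by (simp add: c_def)
  \<comment> \<open>The scaling \<open>2 / \<mu>\<close> cancels the translation length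
    \<open>\<mu> / 2\<close>.\<close>
  have a: "1 + - c * of_real (\<mu> / 2) = 1 - \<i> * of_real \<theta>"
    using variance_pos by (simp add: c_def)
  have "(\<lambda>n. \<Prod>j<n. \<phi>' ((\<phi> ^^ j) (s n))) \<longlonglongrightarrow> 1 / (1 - \<i> * of_real \<theta>) ^ 2"
    unfolding a[symmetric]
  proof (rule gf_funpow_asymp)
    show "norm (s n) \<le> 1" for n by (simp add: s_def c_def norm_exp_eq_Re)
    show "(\<lambda>n. of_nat n * (1 - s n)) \<longlonglongrightarrow> - c" unfolding s_def by (rule exp_scaled_tendsto)
    show "1 + - c * of_real (\<mu> / 2) \<noteq> 0" unfolding a by (auto simp: complex_eq_iff)
  qed (use c in simp)
  moreover have "s \<longlonglongrightarrow> exp 0"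
    unfolding s_def by (intro tendsto_exp lim_const_over_n)
  ultimately have "(\<lambda>n. s n * (\<Prod>j<n. \<phi>' ((\<phi> ^^ j) (s n)))) \<longlonglongrightarrow> exp 0 * (1 / (1 - \<i> * of_real \<theta>) ^ 2)"
    by (rule tendsto_mult[rotated])
  moreover have "\<forall>\<^sub>F n in sequentially.
      s n * (\<Prod>j<n. \<phi>' ((\<phi> ^^ j) (s n))) = char (scaled_law n) \<theta>"
    using eventually_ge_at_top[of 1]
    by eventually_elim (simp add: char_scaled_law s_def c_def Let_def)
  ultimately show ?thesis by (simp add: tendsto_cong)
qed

lemma weak_conv_scaled_law: "weak_conv_m scaled_law (density lborel (erlang_density 1 1))"
  by (rule levy_continuity[OF real_distribution_scaled_law real_distribution_erlang])
     (simp only: char_erlang_1_1 char_scaled_law_tendsto)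

end

end

theorem theorem9:
  fixes D :: nat and E :: "nat \<Rightarrow> real" and \<beta> :: real
    and P :: "nat \<Rightarrow> vertex set pmf" and Pinf :: "vertex set measure"
    and p :: "nat \<Rightarrow> real"
  assumes "D \<ge> 2"
    and "\<And>n. n \<ge> 1 \<Longrightarrow> is_trunc_limit D E \<beta> n (P n)"
    and "is_projective_limit D P Pinf"
    and "is_arg_min (free_energy D E \<beta>) (\<lambda>q. q \<in> simplex_mean_one D) p"
  shows "let \<mu> = offspring_variance D p in \<mu> > 0 \<and>
    weak_conv_m
      (\<lambda>n. distr Pinf borel (\<lambda>T. real (generation_size n T) / real n * (2 / \<mu>)))
      (density lborel (\<lambda>t. ennreal (if t \<ge> 0 then t * exp (- t) else 0)))"
proof -
  obtain C r where gibbs: "C > 0" "r > 0" "\<And>i. i \<le> D \<Longrightarrow> p i = C * r ^ i * exp (- \<beta> * E i)"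
    using free_energy_minimizer[OF assms(1,4)] by metis
  have "p \<in> simplex_mean_one D" using assms(4) by (simp add: is_arg_min_def)
  \<comment> \<open>Strict positivity of the weights comes from their exponential form, the two sums
    from membership in the simplex.\<close>
  then interpret critical_offspring D p
    by unfold_locales (use assms(1) gibbs in \<open>auto simp: simplex_mean_one_def\<close>)
  interpret size_conditioned_limit D p P
    by (rule size_conditioned_limit_gibbs[OF gibbs assms(2)])
  show ?thesis
    using variance_pos weak_conv_scaled_law[OF assms(3)]
    unfolding scaled_law_def[OF assms(3), abs_def] gamma2_density_eq_erlang by (simp add: Let_def)
qed

end
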